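(* Let $N$ be a lattice with dual lattice $M$, let $\Delta\subset N_{\mathbb R}$ be a complete fan, and let $\mathfrak E$ be a tropical bundle of rank $r$ on $\Delta$ with piecewise linear map $\Phi:|\Delta|\to \operatorname{Berg}(\mathrm M)$, where $\mathrm M$ is a loopless matroid of rank $r$. Suppose that $\mathfrak E$ has trivial Chern class and affinely independent (global equivariant) Chern roots $\boldsymbol u=\{u_1,\dots,u_r\}\subset M$. Let $U:|\Delta|\to\mathbb R^r/\mathbb R\boldsymbol 1$ be the linear map given by $U(x)=(\langle u_1,x\rangle,\dots,\langle u_r,x\rangle)$. Then there exist (1) a complete fan $\Xi$ in $\mathbb R^r/\mathbb R\boldsymbol 1$ that coarsens the $(r-1)$-dimensional permutohedral fan $\Sigma_r$, (2) a tropical bundle $\mathfrak F$ of rank $r$ on $\Xi$ with PL map $\Psi:|\Xi|\to\operatorname{Berg}(\mathrm M)$, and (3) a character $u\in M$, such that $U:\Delta\to\Xi$ is a surjective morphism of fans and $\Psi\circ U=\Phi\otimes u$. In other words, $\mathfrak E\otimes\mathfrak O(u)$ is isomorphic to $U^*\mathfrak F$, where $\mathfrak O(u)$ is the tropical line bundle determined by $u:|\Delta|\to\mathbb R$.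
   Context: **Fans.** Fans are rational polyhedral fans with respect to the given lattice (for $\mathbb R^r/\mathbb R\boldsymbol 1$ the lattice is $\mathbb Z^r/\mathbb Z\boldsymbol 1$, $\boldsymbol 1$ the all-ones vector); fans are allowed to have nonzero lineality space. $|\Delta|$ is the support. A complete fan $\Xi$ coarsens a complete fan $\Sigma$ if every cone of $\Sigma$ is contained in a cone of $\Xi$. A morphism of fans $\Delta\to\Xi$ is an integral linear map sending each cone of $\Delta$ into a cone of $\Xi$. The permutohedral fan $\Sigma_r\subset\mathbb R^r/\mathbb R\boldsymbol 1$ is the fan cut out by all hyperplanes $x_i-x_j=0$, $i<j$. **Bergman fan.** Let $\mathrm M$ be a loopless matroid of rank $r$ on a ground set $\mathrm E$, with closure operator $\operatorname{cl}_{\mathrm M}$. Write $e_S=\sum_{s\in S}e_s\in\mathbb R^{\mathrm E}$. The (lifted) Bergman fan $\operatorname{Berg}(\mathrm M)\subset\mathbb R^{\mathrm E}$ consists of the cones $\operatorname{cone}(e_{F^1},\dots,e_{F^{k-1}})+\mathbb R\boldsymbol 1$ for all flags of flats $\varnothing\subset F^1\subset\dots\subset F^k=\mathrm E$ (strict inclusions) of $\mathrm M$. For a basis $B$ of $\mathrm M$ there is a PL map $\phi_B:\mathbb R^B\cong\mathbb R^r\to\operatorname{Berg}(\mathrm M)$ given by $\phi_B(w)_i=w_i$ if $i\in B$ and $\phi_B(w)_i=\min\{w_j\mid j\in C_i(B)\setminus i\}$ otherwise, where $C_i(B)$ is the fundamental circuit of $i$ with respect to $B$. It is a PL isomorphism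 onto its image (the apartment of $B$), with inverse the coordinate projection $\pi_B$. **Tropical bundles.** A tropical (toric vector) bundle $\mathfrak E$ of rank $r$ on a fan $\Delta\subset N_{\mathbb R}$ is given by a map $\Phi:|\Delta|\to\operatorname{Berg}(\mathrm M)$, $\mathrm M$ of rank $r$, called its piecewise linear (PL) map, such that for each cone $\delta\in\Delta$ there exist a basis $B_\delta$ of $\mathrm M$ (ordered, to identify $\mathbb R^{B_\delta}$ with $\mathbb R^r$) and an integral linear map $T_\delta:\operatorname{span}|\delta|\to\mathbb R^r$ with $\Phi|_\delta=\phi_{B_\delta}\circ T_\delta$. The components of $T_\delta=(u_1,\dots,u_r)$ are called local equivariant Chern roots at $\delta$. **Chern class.** The $i$-th equivariant Chern class of $\mathfrak E$ is the piecewise polynomial function given on each $\delta$ by $\epsilon_i\circ\pi_{B_\delta}\circ\Phi|_\delta$, with $\epsilon_i$ the $i$-th elementary symmetric polynomial; the total equivariant Chern class is $c^T=1+c^T_1+\dots+c^T_r$. $\mathfrak E$ has trivial Chern class if $c^T$ is globally polynomial on $|\Delta|$. For complete $\Delta$ this is equivalent to the existence of a global multiset of equivariant Chern roots $\boldsymbol u=\{u_1,\dots,u_r\}\subset M$, i.e. one can take $T_\delta=(u_1,\dots,u_r)$ (restricted to $\operatorname{span}|\delta|$) for every $\delta\in\Delta$, after suitably ordering $B_\delta$. **Twisting and pullback.** For $u\in M$, $\mathfrak E\otimes\mathfrak O(u)$ is the tropical bundle with PL map $\Phi\otimes u$ given by $(\Phi\otimes u)|_\delta(x)=\phi_{B_\delta}(T_\delta(x)+u(x)\boldsymbol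 1)$. For a morphism of fans $U:\Delta\to\Xi$ and a tropical bundle $\mathfrak F$ on $\Xi$ with PL map $\Psi$, $U^*\mathfrak F$ is the tropical bundle with PL map $\Psi\circ U$. *)

theory Defs
  imports "HOL-Analysis.Analysis" "HOL-Combinatorics.Permutations"
begin

section \<open>Lattices and fans\<close>

text \<open>The vector space \<open>N\<^sub>\<real>\<close> is a type of class \<^class>\<open>real_vector\<close>, of finite
  dimension because it carries a lattice. The class \<^class>\<open>euclidean_space\<close> would exclude
  dimension 0, and thereby \<open>\<real>\<^sup>r/\<real>1\<close> for \<open>r = 1\<close>.\<close>

definition lattice_in :: "'a::real_vector set \<Rightarrow> bool" where
  "lattice_in N \<longleftrightarrow> (\<exists>B. finite B \<and> independent B \<and> span B = UNIV \<and>
     N = {\<Sum>b\<in>B. of_int (c b) *\<^sub>R b | c :: 'a \<Rightarrow> int. True})"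

definition dual_lattice :: "'a::real_vector set \<Rightarrow> ('a \<Rightarrow> real) set" where
  "dual_lattice N = {u. linear u \<and> (\<forall>x\<in>N. u x \<in> \<int>)}"

definition rational_cone :: "'a::real_vector set \<Rightarrow> 'a set \<Rightarrow> bool" where
  "rational_cone N \<sigma> \<longleftrightarrow> (\<exists>S. finite S \<and> S \<subseteq> N \<and> \<sigma> = convex_cone hull S)"

text \<open>The empty set is a face in the sense of \<^const>\<open>face_of\<close>, but not a cone.
  Cones need not be pointed.\<close>

definition fan :: "'a::real_vector set \<Rightarrow> 'a set set \<Rightarrow> bool" where
  "fan N \<Delta> \<longleftrightarrow> finite \<Delta> \<and> (\<forall>\<sigma>\<in>\<Delta>. rational_cone N \<sigma>) \<and>
     (\<forall>\<sigma>\<in>\<Delta>. \<forall>\<tau>. \<tau> face_of \<sigma> \<and> \<tau> \<noteq> {} \<longrightarrow> \<tau> \<in> \<Delta>) \<and>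
     (\<forall>\<sigma>\<in>\<Delta>. \<forall>\<tau>\<in>\<Delta>. \<sigma> \<inter> \<tau> face_of \<sigma> \<and> \<sigma> \<inter> \<tau> face_of \<tau>)"

definition complete_fan :: "'a::real_vector set \<Rightarrow> 'a set set \<Rightarrow> bool" where
  "complete_fan N \<Delta> \<longleftrightarrow> fan N \<Delta> \<and> \<Union>\<Delta> = UNIV"

definition coarsens :: "'a set set \<Rightarrow> 'a set set \<Rightarrow> bool" where
  "coarsens \<Xi> \<Sigma> \<longleftrightarrow> (\<forall>\<sigma>\<in>\<Sigma>. \<exists>\<xi>\<in>\<Xi>. \<sigma> \<subseteq> \<xi>)"

definition fan_morphism :: "'a::real_vector set \<Rightarrow> 'a set set \<Rightarrow>
    'b::real_vector set \<Rightarrow> 'b set set \<Rightarrow> ('a \<Rightarrow> 'b) \<Rightarrow> bool" where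
  "fan_morphism N \<Delta> L \<Xi> f \<longleftrightarrow> linear f \<and> f ` N \<subseteq> L \<and> (\<forall>\<delta>\<in>\<Delta>. \<exists>\<xi>\<in>\<Xi>. f ` \<delta> \<subseteq> \<xi>)"

definition int_vectors :: "(real^'n) set" where
  "int_vectors = {v. \<forall>i. v $ i \<in> \<int>}"


section \<open>The space \<open>\<real>\<^sup>r/\<real>1\<close> and the permutohedral fan\<close>

text \<open>The index type \<^typ>\<open>'r\<close> has \<open>r\<close> elements, and \<^term>\<open>1 :: real^'r\<close> is the
  all-ones vector.\<close>

quotient_type (overloaded) 'r mod_ones = "real^'r" / "\<lambda>x y. \<exists>c. x - y = c *\<^sub>R 1"
  morphisms rep_mod_ones mod_ones
proof (rule equivpI)
  show "reflp (\<lambda>x y::real^'r. \<exists>c. x - y = c *\<^sub>R 1)"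
    by (rule reflpI) (auto intro: exI[of _ 0])
  show "symp (\<lambda>x y::real^'r. \<exists>c. x - y = c *\<^sub>R 1)"
    by (rule sympI) (metis minus_diff_eq scaleR_minus_left)
  show "transp (\<lambda>x y::real^'r. \<exists>c. x - y = c *\<^sub>R 1)"
  proof (rule transpI)
    fix x y z :: "real^'r"
    assume "\<exists>c. x - y = c *\<^sub>R 1" "\<exists>c. y - z = c *\<^sub>R 1"
    then obtain c d where cd: "x - y = c *\<^sub>R 1" "y - z = d *\<^sub>R 1" by blast
    have "x - z = (x - y) + (y - z)" by simp
    also have "\<dots> = (c + d) *\<^sub>R 1" by (simp only: cd scaleR_left.add)
    finally show "\<exists>c. x - z = c *\<^sub>R 1" by blast
  qed
qed

instantiation mod_ones :: (finite) real_vector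
begin

lift_definition zero_mod_ones :: "'a mod_ones" is 0 .

lift_definition plus_mod_ones :: "'a mod_ones \<Rightarrow> 'a mod_ones \<Rightarrow> 'a mod_ones" is "(+)"
proof -
  fix x y x' y' :: "real^'a"
  assume "\<exists>c. x - y = c *\<^sub>R 1" "\<exists>c. x' - y' = c *\<^sub>R 1"
  then obtain c d where "x - y = c *\<^sub>R 1" "x' - y' = d *\<^sub>R 1" by blast
  then have "x + x' - (y + y') = (c + d) *\<^sub>R 1"
    by (simp only: add_diff_add scaleR_left.add)
  then show "\<exists>c. x + x' - (y + y') = c *\<^sub>R 1" by blast
qed

lift_definition uminus_mod_ones :: "'a mod_ones \<Rightarrow> 'a mod_ones" is uminus
proof -
  fix x y :: "real^'a"
  assume "\<exists>c. x - y = c *\<^sub>R 1"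
  then obtain c where "x - y = c *\<^sub>R 1" by blast
  then have "- x - - y = (- c) *\<^sub>R 1"
    by (simp only: minus_diff_minus scaleR_minus_left)
  then show "\<exists>c. - x - - y = c *\<^sub>R 1" by blast
qed

lift_definition minus_mod_ones :: "'a mod_ones \<Rightarrow> 'a mod_ones \<Rightarrow> 'a mod_ones" is "(-)"
proof -
  fix x y x' y' :: "real^'a"
  assume "\<exists>c. x - y = c *\<^sub>R 1" "\<exists>c. x' - y' = c *\<^sub>R 1"
  then obtain c d where cd: "x - y = c *\<^sub>R 1" "x' - y' = d *\<^sub>R 1" by blast
  have "x - x' - (y - y') = (x - y) - (x' - y')" by simp
  also have "\<dots> = (c - d) *\<^sub>R 1" by (simp only: cd scaleR_left.diff)
  finally show "\<exists>c. x - x' - (y - y') = c *\<^sub>R 1" by blast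
qed

lift_definition scaleR_mod_ones :: "real \<Rightarrow> 'a mod_ones \<Rightarrow> 'a mod_ones" is "(*\<^sub>R)"
proof -
  fix a :: real and x y :: "real^'a"
  assume "\<exists>c. x - y = c *\<^sub>R 1"
  then obtain c where "x - y = c *\<^sub>R 1" by blast
  then have "a *\<^sub>R x - a *\<^sub>R y = (a * c) *\<^sub>R 1"
    by (simp only: scaleR_right_diff_distrib[symmetric] scaleR_scaleR)
  then show "\<exists>c. a *\<^sub>R x - a *\<^sub>R y = c *\<^sub>R 1" by blast
qed

instance
  by standard
    (transfer, rule exI[of _ 0], simp add: algebra_simps)+

end

definition mod_ones_lattice :: "('r::finite) mod_ones set" where
  "mod_ones_lattice = mod_ones ` int_vectors"

text \<open>Each cone is the closed cell, of the arrangement of the hyperplanes \<open>x\<^sub>i = x\<^sub>j\<close>,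
  whose relative interior contains the class of \<open>x\<close>.\<close>

definition permutohedral_fan :: "('r::finite) mod_ones set set" where
  "permutohedral_fan =
     {mod_ones ` {y. \<forall>i j. x $ i \<le> x $ j \<longrightarrow> y $ i \<le> y $ j} | x :: real^'r. True}"


section \<open>Matroids\<close>

text \<open>The ground set \<open>E\<close> is the whole finite type \<^typ>\<open>'e\<close>, so that \<open>\<real>\<^sup>E\<close> is
  \<^typ>\<open>real^'e\<close>; a matroid is given by its independent sets.\<close>

definition matroid :: "('e::finite set \<Rightarrow> bool) \<Rightarrow> bool" where
  "matroid indep \<longleftrightarrow> indep {} \<and> (\<forall>X Y. indep Y \<and> X \<subseteq> Y \<longrightarrow> indep X) \<and>
     (\<forall>X Y. indep X \<and> indep Y \<and> card X < card Y \<longrightarrow> (\<exists>y\<in>Y - X. indep (insert y X)))"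

definition loopless :: "('e::finite set \<Rightarrow> bool) \<Rightarrow> bool" where
  "loopless indep \<longleftrightarrow> (\<forall>e. indep {e})"

definition mrank :: "('e::finite set \<Rightarrow> bool) \<Rightarrow> 'e set \<Rightarrow> nat" where
  "mrank indep S = Max {card X | X. X \<subseteq> S \<and> indep X}"

definition mcl :: "('e::finite set \<Rightarrow> bool) \<Rightarrow> 'e set \<Rightarrow> 'e set" where
  "mcl indep S = {e. mrank indep (insert e S) = mrank indep S}"

definition mflat :: "('e::finite set \<Rightarrow> bool) \<Rightarrow> 'e set \<Rightarrow> bool" where
  "mflat indep F \<longleftrightarrow> mcl indep F = F"

definition mbasis :: "('e::finite set \<Rightarrow> bool) \<Rightarrow> 'e set \<Rightarrow> bool" where
  "mbasis indep B \<longleftrightarrow> indep B \<and> (\<forall>X. indep X \<and> B \<subseteq> X \<longrightarrow> X = B)"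

definition mcircuit :: "('e::finite set \<Rightarrow> bool) \<Rightarrow> 'e set \<Rightarrow> bool" where
  "mcircuit indep C \<longleftrightarrow> \<not> indep C \<and> (\<forall>X. X \<subset> C \<longrightarrow> indep X)"

definition fund_circuit :: "('e::finite set \<Rightarrow> bool) \<Rightarrow> 'e set \<Rightarrow> 'e \<Rightarrow> 'e set" where
  "fund_circuit indep B i = (THE C. mcircuit indep C \<and> C \<subseteq> insert i B)"


section \<open>Bergman fans and apartments\<close>

definition ind_vec :: "'e set \<Rightarrow> real^('e::finite)" where
  "ind_vec S = (\<Sum>s\<in>S. axis s 1)"

text \<open>A flag of flats is encoded as the chain of its proper members; the final \<open>F\<^sup>k = E\<close>
  is implicit.\<close>

definition bergman_fan :: "('e::finite set \<Rightarrow> bool) \<Rightarrow> (real^'e) set set" where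
  "bergman_fan indep =
     {{x + c *\<^sub>R 1 | x c. x \<in> convex_cone hull (ind_vec ` \<F>)} | \<F>.
        chain\<^sub>\<subseteq> \<F> \<and> (\<forall>F\<in>\<F>. mflat indep F \<and> F \<noteq> {} \<and> F \<noteq> UNIV)}"

definition ordered_basis :: "('e::finite set \<Rightarrow> bool) \<Rightarrow> ('r::finite \<Rightarrow> 'e) \<Rightarrow> bool" where
  "ordered_basis indep b \<longleftrightarrow> inj b \<and> mbasis indep (range b)"

text \<open>The map \<open>\<phi>\<^sub>B\<close> for \<open>B = range b\<close>, where the ordering \<open>b\<close> identifies \<open>\<real>\<^sup>B\<close> with
  \<open>\<real>\<^sup>r\<close>: the coordinate of \<open>w\<close> at \<open>j \<in> B\<close> is \<open>w $ inv b j\<close>.\<close>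

definition apartment_map ::
    "('e::finite set \<Rightarrow> bool) \<Rightarrow> ('r::finite \<Rightarrow> 'e) \<Rightarrow> real^'r \<Rightarrow> real^'e" where
  "apartment_map indep b w = (\<chi> i. if i \<in> range b then w $ inv b i
     else Min ((\<lambda>j. w $ inv b j) ` (fund_circuit indep (range b) i - {i})))"

definition basis_proj :: "('r::finite \<Rightarrow> 'e::finite) \<Rightarrow> real^'e \<Rightarrow> real^'r" where
  "basis_proj b v = (\<chi> j. v $ b j)"


section \<open>Tropical bundles\<close>

text \<open>A linear map on \<open>span \<delta>\<close> is represented by a linear extension \<open>T\<close> to the whole
  space; integrality is required on the lattice \<open>N \<inter> span \<delta>\<close> only.\<close>

definition bundle_chart :: "'a::real_vector set \<Rightarrow> ('e::finite set \<Rightarrow> bool) \<Rightarrow> ('a \<Rightarrow> real^'e) \<Rightarrow>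
    'a set \<Rightarrow> ('r::finite \<Rightarrow> 'e) \<Rightarrow> ('a \<Rightarrow> real^'r) \<Rightarrow> bool" where
  "bundle_chart N indep \<Phi> \<delta> b T \<longleftrightarrow> ordered_basis indep b \<and>
     linear T \<and> T ` (N \<inter> span \<delta>) \<subseteq> int_vectors \<and> (\<forall>x\<in>\<delta>. \<Phi> x = apartment_map indep b (T x))"

text \<open>The rank of the bundle is \<open>CARD('r)\<close>. The values of \<open>\<Phi>\<close> outside the support of
  \<open>\<Delta>\<close> are irrelevant.\<close>

definition tropical_bundle :: "'r::finite itself \<Rightarrow> 'a::real_vector set \<Rightarrow>
    ('e::finite set \<Rightarrow> bool) \<Rightarrow> 'a set set \<Rightarrow> ('a \<Rightarrow> real^'e) \<Rightarrow> bool" where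
  "tropical_bundle _ N indep \<Delta> \<Phi> \<longleftrightarrow> \<Phi> ` \<Union>\<Delta> \<subseteq> \<Union>(bergman_fan indep) \<and>
     (\<forall>\<delta>\<in>\<Delta>. \<exists>(b :: 'r \<Rightarrow> 'e) T. bundle_chart N indep \<Phi> \<delta> b T)"

definition elem_sym :: "nat \<Rightarrow> real^('r::finite) \<Rightarrow> real" where
  "elem_sym i w = (\<Sum>S\<in>{S. card S = i}. \<Prod>j\<in>S. w $ j)"

text \<open>The Chern class and the twist choose a chart at each point; \<open>chern_class_chart\<close> and
  \<open>twist_chart\<close> below show that every chart gives the same value.\<close>

definition chern_class :: "'r::finite itself \<Rightarrow> 'a::real_vector set \<Rightarrow>
    ('e::finite set \<Rightarrow> bool) \<Rightarrow> 'a set set \<Rightarrow> ('a \<Rightarrow> real^'e) \<Rightarrow> nat \<Rightarrow> 'a \<Rightarrow> real" where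
  "chern_class _ N indep \<Delta> \<Phi> i x =
     (let b = (SOME b :: 'r \<Rightarrow> 'e. \<exists>\<delta>\<in>\<Delta>. x \<in> \<delta> \<and> (\<exists>T. bundle_chart N indep \<Phi> \<delta> b T))
      in elem_sym i (basis_proj b (\<Phi> x)))"

definition total_chern_class :: "'r::finite itself \<Rightarrow> 'a::real_vector set \<Rightarrow>
    ('e::finite set \<Rightarrow> bool) \<Rightarrow> 'a set set \<Rightarrow> ('a \<Rightarrow> real^'e) \<Rightarrow> 'a \<Rightarrow> real" where
  "total_chern_class r N indep \<Delta> \<Phi> x = 1 + (\<Sum>i=1..CARD('r). chern_class r N indep \<Delta> \<Phi> i x)"

text \<open>Like \<^const>\<open>real_polynomial_function\<close>, which needs a norm.\<close>

inductive polynomial_fun :: "('a::real_vector \<Rightarrow> real) \<Rightarrow> bool" where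
  linear: "linear f \<Longrightarrow> polynomial_fun f"
| const: "polynomial_fun (\<lambda>x. c)"
| add: "polynomial_fun f \<Longrightarrow> polynomial_fun g \<Longrightarrow> polynomial_fun (\<lambda>x. f x + g x)"
| mult: "polynomial_fun f \<Longrightarrow> polynomial_fun g \<Longrightarrow> polynomial_fun (\<lambda>x. f x * g x)"

definition trivial_chern_class :: "'r::finite itself \<Rightarrow> 'a::real_vector set \<Rightarrow>
    ('e::finite set \<Rightarrow> bool) \<Rightarrow> 'a set set \<Rightarrow> ('a \<Rightarrow> real^'e) \<Rightarrow> bool" where
  "trivial_chern_class r N indep \<Delta> \<Phi> \<longleftrightarrow>
     (\<exists>p. polynomial_fun p \<and> (\<forall>x\<in>\<Union>\<Delta>. total_chern_class r N indep \<Delta> \<Phi> x = p x))"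

definition global_chern_roots :: "'a::real_vector set \<Rightarrow> ('e::finite set \<Rightarrow> bool) \<Rightarrow>
    'a set set \<Rightarrow> ('a \<Rightarrow> real^'e) \<Rightarrow> ('r::finite \<Rightarrow> 'a \<Rightarrow> real) \<Rightarrow> bool" where
  "global_chern_roots N indep \<Delta> \<Phi> u \<longleftrightarrow> (\<forall>i. u i \<in> dual_lattice N) \<and>
     (\<forall>\<delta>\<in>\<Delta>. \<exists>b. bundle_chart N indep \<Phi> \<delta> b (\<lambda>x. \<chi> i. u i x))"

definition affinely_independent :: "('r::finite \<Rightarrow> 'a \<Rightarrow> real) \<Rightarrow> bool" where
  "affinely_independent u \<longleftrightarrow>
     (\<forall>c. (\<Sum>i\<in>UNIV. c i) = 0 \<and> (\<forall>x. (\<Sum>i\<in>UNIV. c i * u i x) = 0) \<longrightarrow> (\<forall>i. c i = 0))"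

text \<open>The linear map \<open>U\<close> to \<open>\<real>\<^sup>r/\<real>1\<close> determined by the roots.\<close>

definition root_map :: "('r::finite \<Rightarrow> 'a \<Rightarrow> real) \<Rightarrow> 'a \<Rightarrow> 'r mod_ones" where
  "root_map u x = mod_ones (\<chi> i. u i x)"

text \<open>The PL map of the twist by the line bundle of \<open>u\<close>.\<close>

definition twist :: "'r::finite itself \<Rightarrow> 'a::real_vector set \<Rightarrow> ('e::finite set \<Rightarrow> bool) \<Rightarrow>
    'a set set \<Rightarrow> ('a \<Rightarrow> real^'e) \<Rightarrow> ('a \<Rightarrow> real) \<Rightarrow> 'a \<Rightarrow> real^'e" where
  "twist _ N indep \<Delta> \<Phi> u x =
     (let (b, T) = (SOME (b :: 'r \<Rightarrow> 'e, T). \<exists>\<delta>\<in>\<Delta>. x \<in> \<delta> \<and> bundle_chart N indep \<Phi> \<delta> b T)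
      in apartment_map indep b (T x + u x *\<^sub>R 1))"


subsection \<open>Independence of the chosen charts\<close>

lemma ex_mcircuit:
  assumes "\<not> indep (X :: 'e::finite set)"
  shows "\<exists>C\<subseteq>X. mcircuit indep C"
proof -
  have "finite X" by simp
  then show ?thesis
    using assms
  proof (induction X rule: finite_psubset_induct)
    case (psubset X)
    then show ?case
      unfolding mcircuit_def by (metis order.refl psubset_imp_subset subset_trans)
  qed
qed

lemma ex1_fund_circuit:
  assumes m: "matroid indep" and B: "mbasis indep B" and i: "i \<notin> B"
  shows "\<exists>!C. mcircuit indep C \<and> C \<subseteq> insert i B"
proof -
  have "\<not> indep (insert i B)"
    using B i unfolding mbasis_def by blast
  then have ex: "\<exists>C. mcircuit indep C \<and> C \<subseteq> insert i B"
    using ex_mcircuit[of indep "insert i B"] by blast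
  have sub: "indep X" if "indep Y" "X \<subseteq> Y" for X Y
    using m that unfolding matroid_def by blast
  have aug: "\<exists>y\<in>Y - X. indep (insert y X)" if "indep X" "indep Y" "card X < card Y" for X Y
    using m that unfolding matroid_def by blast
  have indB: "indep B" using B unfolding mbasis_def by blast
  have le: "C1 \<subseteq> C2" if C1: "mcircuit indep C1" "C1 \<subseteq> insert i B"
    and C2: "mcircuit indep C2" "C2 \<subseteq> insert i B" for C1 C2
  proof
    fix f assume f: "f \<in> C1"
    show "f \<in> C2"
    proof (rule ccontr)
      assume fC2: "f \<notin> C2"
      have start: "indep (C1 - {f})"
        using C1(1) f unfolding mcircuit_def by blast
      define P where "P X \<longleftrightarrow> indep X \<and> C1 - {f} \<subseteq> X \<and> X \<subseteq> insert i B" for X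
      have P0: "P (C1 - {f})" using start C1(2) unfolding P_def by auto
      obtain I where I: "P I" "\<And>X. P X \<Longrightarrow> card X \<le> card I"
        using ex_has_greatest_nat[of P "C1 - {f}" card "Suc (card (insert i B))"] P0
        by (metis P_def card_mono finite le_imp_less_Suc)
      have Ii: "indep I" "C1 - {f} \<subseteq> I" "I \<subseteq> insert i B" using I(1) unfolding P_def by auto
      have dep: "\<not> indep C1" "\<not> indep C2"
        using C1(1) C2(1) unfolding mcircuit_def by auto
      have fI: "f \<notin> I"
      proof
        assume "f \<in> I"
        then have "C1 \<subseteq> I" using Ii(2) by blast
        then show False using sub[OF Ii(1)] dep(1) by simp
      qed
      have "\<not> card I < card B"
      proof
        assume "card I < card B"
        then obtain y where y: "y \<in> B - I" "indep (insert y I)"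
          using aug[OF Ii(1) indB] by blast
        have "insert y I \<subseteq> insert i B" "C1 - {f} \<subseteq> insert y I" using y(1) Ii by auto
        with y(2) have "P (insert y I)" unfolding P_def by simp
        then have "card (insert y I) \<le> card I" by (rule I(2))
        then show False using y(1) by simp
      qed
      moreover have sI: "I \<subseteq> insert i B - {f}" using Ii(3) fI by blast
      moreover have "card (insert i B - {f}) = card B"
        using f C1(2) i by (simp add: card_Diff_singleton_if subset_iff)
      ultimately have "I = insert i B - {f}"
        by (intro card_seteq) auto
      then have "C2 \<subseteq> I" using C2(2) fC2 by blast
      then show False using sub[OF Ii(1)] dep(2) by simp
    qed
  qed
  then show ?thesis using ex by (auto intro!: ex_ex1I subset_antisym)
qed

lemma fund_circuit:
  assumes "matroid indep" "mbasis indep B" "i \<notin> B"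
  shows "mcircuit indep (fund_circuit indep B i)" "fund_circuit indep B i \<subseteq> insert i B"
  using theI'[OF ex1_fund_circuit[OF assms]] unfolding fund_circuit_def by auto

lemma fund_circuit_nonempty:
  assumes "matroid indep" "loopless indep" "mbasis indep B" "i \<notin> B"
  shows "fund_circuit indep B i - {i} \<noteq> {}"
proof
  assume "fund_circuit indep B i - {i} = {}"
  then have "fund_circuit indep B i \<subseteq> {i}" by blast
  then have "indep (fund_circuit indep B i)"
    using assms(1,2) unfolding matroid_def loopless_def by blast
  then show False
    using fund_circuit(1)[OF assms(1,3,4)] unfolding mcircuit_def by blast
qed

lemma apartment_map_basis:
  assumes "inj b" shows "apartment_map indep b w $ b j = w $ j"
  using assms by (simp add: apartment_map_def)

lemma basis_proj_apartment_map:
  assumes "inj b" shows "basis_proj b (apartment_map indep b w) = w"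
  using assms by (simp add: basis_proj_def apartment_map_basis)

lemma apartment_map_shift:
  assumes "matroid indep" "loopless indep" "ordered_basis indep b"
  shows "apartment_map indep b (w + c *\<^sub>R 1) = apartment_map indep b w + c *\<^sub>R 1"
proof (rule vec_eq_iff[THEN iffD2], rule allI)
  fix i
  show "apartment_map indep b (w + c *\<^sub>R 1) $ i = (apartment_map indep b w + c *\<^sub>R 1) $ i"
  proof (cases "i \<in> range b")
    case True
    then show ?thesis by (simp add: apartment_map_def)
  next
    case False
    define S where "S = fund_circuit indep (range b) i - {i}"
    have "S \<noteq> {}"
      using fund_circuit_nonempty[of indep "range b" i] assms False
      unfolding S_def ordered_basis_def by blast
    then have "Min ((\<lambda>j. w $ inv b j + c) ` S) = Min ((\<lambda>j. w $ inv b j) ` S) + c"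
      by (intro Min_add_commute) auto
    then show ?thesis using False by (simp add: apartment_map_def S_def)
  qed
qed

lemma card_level_le:
  fixes b b' :: "'r::finite \<Rightarrow> 'e::finite"
  assumes m: "matroid indep" "loopless indep"
    and b: "ordered_basis indep b" and b': "ordered_basis indep b'"
    and eq: "apartment_map indep b w = apartment_map indep b' w'"
  shows "card {j. t \<le> w' $ j} \<le> card {j. t \<le> w $ j}"
proof (rule ccontr)
  let ?X = "b ` {j. t \<le> w $ j}" and ?Y = "b' ` {j. t \<le> w' $ j}"
  assume "\<not> ?thesis"
  then have "card ?X < card ?Y"
    using b b' unfolding ordered_basis_def by (simp add: card_image inj_on_def)
  moreover have "indep ?X" "indep ?Y"
    using b b' m unfolding ordered_basis_def mbasis_def matroid_def
    by (meson image_mono subset_UNIV)+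
  ultimately obtain e where e: "e \<in> ?Y - ?X" "indep (insert e ?X)"
    using m unfolding matroid_def by blast
  then obtain k where k: "e = b' k" "t \<le> w' $ k" by blast
  then have v: "t \<le> apartment_map indep b w $ e"
    using apartment_map_basis[of b'] b' unfolding eq ordered_basis_def by simp
  show False
  proof (cases "e \<in> range b")
    case True
    then obtain j where j: "e = b j" by blast
    have "t \<le> w $ j"
      using v b apartment_map_basis[of b indep w j] unfolding ordered_basis_def j by simp
    then show False using e(1) j by blast
  next
    case False
    let ?C = "fund_circuit indep (range b) e"
    have bb: "inj b" "mbasis indep (range b)" using b unfolding ordered_basis_def by auto
    have "?C \<subseteq> insert e ?X"
    proof
      fix x assume x: "x \<in> ?C"
      show "x \<in> insert e ?X"
      proof (cases "x = e")
        case False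
        then obtain j where j: "x = b j"
          using fund_circuit(2)[OF m(1) bb(2) \<open>e \<notin> range b\<close>] x by blast
        have "t \<le> Min ((\<lambda>j. w $ inv b j) ` (?C - {e}))"
          using v \<open>e \<notin> range b\<close> by (simp add: apartment_map_def)
        also have "\<dots> \<le> w $ inv b x"
          using x False by (intro Min_le) auto
        also have "\<dots> = w $ j" using j bb(1) by simp
        finally show ?thesis using j by blast
      qed simp
    qed
    then have "indep ?C" using e(2) m unfolding matroid_def by blast
    then show False
      using fund_circuit(1)[OF m(1) bb(2) False] unfolding mcircuit_def by blast
  qed
qed

lemma apartment_map_eq_permutes:
  fixes b b' :: "'r::finite \<Rightarrow> 'e::finite"
  assumes "matroid indep" "loopless indep" "ordered_basis indep b" "ordered_basis indep b'"
    and "apartment_map indep b w = apartment_map indep b' w'"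
  shows "\<exists>\<pi>. \<pi> permutes UNIV \<and> (\<forall>j. w' $ j = w $ \<pi> j)"
proof -
  have lev: "card {j. t \<le> w $ j} = card {j. t \<le> w' $ j}" for t
    using card_level_le[OF assms(1-4)] card_level_le[OF assms(1,2,4,3)] assms(5)
    by (metis le_antisym)
  have "card {j. w $ j = t} = card {j. w' $ j = t}" for t
  proof -
    define A where "A = {z \<in> range (\<lambda>j. w $ j) \<union> range (\<lambda>j. w' $ j). t < z}"
    define s where "s = (if A = {} then t + 1 else Min A)"
    have fin: "finite A" unfolding A_def by simp
    have s: "t < s" unfolding s_def using fin by (auto simp: A_def)
    have "s \<le> z" if "z \<in> A" for z
      unfolding s_def using that fin by auto
    then have ss: "s \<le> w $ j \<or> w $ j \<le> t" "s \<le> w' $ j \<or> w' $ j \<le> t" for j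
      unfolding A_def by force+
    have "{j. w $ j = t} = {j. t \<le> w $ j} - {j. s \<le> w $ j}"
      "{j. w' $ j = t} = {j. t \<le> w' $ j} - {j. s \<le> w' $ j}"
      using ss s by (auto; force)+
    moreover have "{j. s \<le> w $ j} \<subseteq> {j. t \<le> w $ j}" "{j. s \<le> w' $ j} \<subseteq> {j. t \<le> w' $ j}"
      using s by auto
    ultimately show ?thesis by (simp add: card_Diff_subset lev)
  qed
  then have "image_mset (\<lambda>j. w $ j) (mset_set UNIV) = image_mset (\<lambda>j. w' $ j) (mset_set UNIV)"
    by (intro multiset_eqI) (simp add: count_image_mset' vimage_def Int_def eq_commute)
  then obtain \<pi> where "\<pi> permutes UNIV" "\<forall>x\<in>UNIV. w' $ x = w $ \<pi> x"
    using image_mset_eq_implies_permutes[OF finite] by metis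
  then show ?thesis by auto
qed

lemma elem_sym_permute:
  fixes w w' :: "real^'r::finite"
  assumes "\<pi> permutes UNIV" "\<And>j. w' $ j = w $ \<pi> j"
  shows "elem_sym i w' = elem_sym i w"
proof -
  have inj: "inj \<pi>" and bij: "bij \<pi>" using assms(1) by (auto simp: permutes_inj permutes_bij)
  have "bij_betw (image \<pi>) {S. card S = i} {S. card S = i}"
  proof (rule bij_betw_byWitness[where f' = "image (inv \<pi>)"])
    show "\<forall>S\<in>{S. card S = i}. inv \<pi> ` \<pi> ` S = S"
      using inj by (simp add: image_inv_f_f)
    show "\<forall>S\<in>{S. card S = i}. \<pi> ` inv \<pi> ` S = S"
      using bij by (simp add: image_f_inv_f bij_is_surj)
    show "image \<pi> ` {S. card S = i} \<subseteq> {S. card S = i}"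
      using inj by (auto simp: card_image inj_on_def)
    show "image (inv \<pi>) ` {S. card S = i} \<subseteq> {S. card S = i}"
      using bij_imp_bij_inv[OF bij] by (auto simp: card_image bij_def inj_on_def)
  qed
  then have "elem_sym i w = (\<Sum>S\<in>{S. card S = i}. \<Prod>j\<in>\<pi> ` S. w $ j)"
    unfolding elem_sym_def by (rule sum.reindex_bij_betw[symmetric])
  also have "\<dots> = elem_sym i w'"
    unfolding elem_sym_def assms(2)
    by (intro sum.cong refl prod.reindex_cong[where l = \<pi>]) (use inj in \<open>auto simp: inj_on_def\<close>)
  finally show ?thesis by simp
qed

lemma chern_class_chart:
  fixes b :: "'r::finite \<Rightarrow> 'e::finite"
  assumes "matroid indep" "loopless indep"
    and "\<delta> \<in> \<Delta>" "x \<in> \<delta>" "bundle_chart N indep \<Phi> \<delta> b T"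
  shows "chern_class TYPE('r) N indep \<Delta> \<Phi> i x = elem_sym i (basis_proj b (\<Phi> x))"
proof -
  define b' where
    "b' = (SOME b :: 'r \<Rightarrow> 'e. \<exists>\<delta>\<in>\<Delta>. x \<in> \<delta> \<and> (\<exists>T. bundle_chart N indep \<Phi> \<delta> b T))"
  have "\<exists>b :: 'r \<Rightarrow> 'e. \<exists>\<delta>\<in>\<Delta>. x \<in> \<delta> \<and> (\<exists>T. bundle_chart N indep \<Phi> \<delta> b T)"
    using assms by blast
  from someI_ex[OF this] obtain \<delta>' T' where c': "x \<in> \<delta>'" "bundle_chart N indep \<Phi> \<delta>' b' T'"
    unfolding b'_def by blast
  have ob: "ordered_basis indep b" "ordered_basis indep b'"
    and \<Phi>: "\<Phi> x = apartment_map indep b (T x)" "\<Phi> x = apartment_map indep b' (T' x)"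
    using assms(4,5) c' unfolding bundle_chart_def by auto
  have p: "basis_proj b (\<Phi> x) = T x" "basis_proj b' (\<Phi> x) = T' x"
    using ob basis_proj_apartment_map \<Phi> unfolding ordered_basis_def by metis+
  obtain \<pi> where "\<pi> permutes UNIV" "\<And>j. T' x $ j = T x $ \<pi> j"
    using apartment_map_eq_permutes[OF assms(1,2) ob] \<Phi> by metis
  then have "elem_sym i (T' x) = elem_sym i (T x)" by (rule elem_sym_permute)
  then show ?thesis unfolding chern_class_def Let_def b'_def[symmetric] p .
qed

lemma twist_chart:
  fixes b :: "'r::finite \<Rightarrow> 'e::finite"
  assumes "matroid indep" "loopless indep"
    and "\<delta> \<in> \<Delta>" "x \<in> \<delta>" "bundle_chart N indep \<Phi> \<delta> b T"
  shows "twist TYPE('r) N indep \<Delta> \<Phi> u x = apartment_map indep b (T x + u x *\<^sub>R 1)"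
proof -
  define P where
    "P = (\<lambda>(b :: 'r \<Rightarrow> 'e, T). \<exists>\<delta>\<in>\<Delta>. x \<in> \<delta> \<and> bundle_chart N indep \<Phi> \<delta> b T)"
  obtain b' T' where s: "(SOME p. P p) = (b', T')" by fastforce
  have "P (b, T)" using assms unfolding P_def by blast
  then have "P (b', T')" using someI[of P] s by metis
  then have "ordered_basis indep b'" "\<Phi> x = apartment_map indep b' (T' x)"
    unfolding P_def bundle_chart_def by auto
  moreover have "ordered_basis indep b" "\<Phi> x = apartment_map indep b (T x)"
    using assms unfolding bundle_chart_def by auto
  ultimately show ?thesis
    unfolding twist_def P_def[symmetric] s
    by (simp add: apartment_map_shift[OF assms(1,2)])
qed

end

theory Submission
  imports Defs
begin

text \<open>For a set \<open>A\<close> of roots, let \<open>F A\<close> be the flat spanned by the basis elements indexed by \<open>A\<close>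
  in any chart at a point where the roots in \<open>A\<close> exceed the others. The points of this kind form
  a convex set, on which the flat is locally constant, so \<open>F A\<close> is well defined; affine
  independence makes every \<open>A\<close> occur. The map \<open>F\<close> is monotone, \<open>F A\<close> has rank \<open>|A|\<close>, and the
  level sets of \<open>\<Phi> x\<close> are the flats \<open>F {i. t \<le> u\<^sub>i x}\<close>. Hence \<open>\<Phi>\<close>, twisted by the negative of one
  root, factors through \<open>U\<close>.

  An ordered basis \<open>b\<close> gives a chart at \<open>y \<in> \<real>\<^sup>r/\<real>1\<close> if and only if every superlevel set \<open>A\<close> of \<open>y\<close>
  satisfies \<open>b ` A \<subseteq> F A\<close>. Submodularity of the rank shows that these sets \<open>A\<close> form a lattice, so
  such \<open>y\<close> form a convex cone, and that among the lattices whose cone contains a given chamber of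
  \<open>\<Sigma>\<^sub>r\<close> there is a largest one. The cones of these largest lattices are the maximal cones of \<open>\<Xi>\<close>.
  A cone \<open>\<delta>\<close> of \<open>\<Delta>\<close> lies in one whose image under \<open>U\<close> meets the interior of a chamber, and the
  maximality of the lattice puts \<open>U(\<delta>)\<close> into the cone of that chamber.\<close>


section \<open>Matroid rank and closure\<close>

locale matroid_on =
  fixes indep :: "'e::finite set \<Rightarrow> bool"
  assumes matroid: "matroid indep"
begin

abbreviation "rk \<equiv> mrank indep"
abbreviation "cl \<equiv> mcl indep"

lemma indep_subset: "indep Y \<Longrightarrow> X \<subseteq> Y \<Longrightarrow> indep X"
  using matroid unfolding matroid_def by blast

lemma card_le_rk: "indep X \<Longrightarrow> X \<subseteq> S \<Longrightarrow> card X \<le> rk S"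
  unfolding mrank_def by (intro Max_ge) auto

lemma rk_attained: obtains X where "X \<subseteq> S" "indep X" "card X = rk S"
proof -
  have "{card X | X. X \<subseteq> S \<and> indep X} \<noteq> {}"
    using matroid unfolding matroid_def by blast
  then have "rk S \<in> {card X | X. X \<subseteq> S \<and> indep X}"
    unfolding mrank_def by (intro Max_in) auto
  then show thesis using that by force
qed

lemma rk_mono: "S \<subseteq> T \<Longrightarrow> rk S \<le> rk T"
  by (metis rk_attained card_le_rk order_trans)

lemma rk_le_card: "rk S \<le> card S"
  by (metis rk_attained card_mono finite)

lemma rk_indep: "indep X \<Longrightarrow> rk X = card X"
  by (simp add: card_le_rk le_antisym rk_le_card)

lemma extend_to_rk:
  assumes "indep X" "X \<subseteq> S"
  obtains Y where "X \<subseteq> Y" "Y \<subseteq> S" "indep Y" "card Y = rk S"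
proof -
  have "\<exists>Y. X \<subseteq> Y \<and> Y \<subseteq> S \<and> indep Y \<and> card Y = rk S"
    using assms
  proof (induction "rk S - card X" arbitrary: X)
    case 0
    then show ?case using card_le_rk[of X S] by (intro exI[of _ X]) auto
  next
    case (Suc n)
    obtain Z where Z: "Z \<subseteq> S" "indep Z" "card Z = rk S" by (rule rk_attained)
    have "card X < card Z" using Suc.hyps(2) Z(3) by linarith
    then obtain y where y: "y \<in> Z - X" "indep (insert y X)"
      using matroid Suc.prems(1) Z(2) unfolding matroid_def by blast
    have "n = rk S - card (insert y X)" using Suc.hyps(2) y(1) by simp
    then obtain Y where "insert y X \<subseteq> Y" "Y \<subseteq> S" "indep Y" "card Y = rk S"
      using Suc.hyps(1)[of "insert y X"] y Z(1) Suc.prems(2) by blast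
    then show ?case by blast
  qed
  then show thesis using that by blast
qed

lemma rk_submodular: "rk (S \<union> T) + rk (S \<inter> T) \<le> rk S + rk T"
proof -
  obtain I where I: "I \<subseteq> S \<inter> T" "indep I" "card I = rk (S \<inter> T)" by (rule rk_attained)
  \<comment> \<open>A maximal independent subset of the union that extends one of the intersection
    splits into independent subsets of \<open>S\<close> and of \<open>T\<close>.\<close>
  obtain J where J: "I \<subseteq> J" "J \<subseteq> S \<union> T" "indep J" "card J = rk (S \<union> T)"
    using extend_to_rk[OF I(2), of "S \<union> T"] I(1) by blast
  have "card (J \<inter> S) + card (J \<inter> T) = card (J \<inter> S \<union> J \<inter> T) + card ((J \<inter> S) \<inter> (J \<inter> T))"
    by (rule card_Un_Int) simp_all
  moreover have "J \<inter> S \<union> J \<inter> T = J" using J(2) by blast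
  moreover have "card I \<le> card ((J \<inter> S) \<inter> (J \<inter> T))" using I(1) J(1) by (intro card_mono) auto
  moreover have "card (J \<inter> S) \<le> rk S" "card (J \<inter> T) \<le> rk T"
    by (rule card_le_rk; use indep_subset[OF J(3)] in blast)+
  ultimately show ?thesis using I(3) J(4) by auto
qed

lemma mcl_subset: "S \<subseteq> cl S"
  unfolding mcl_def by (auto simp: insert_absorb)

text \<open>An element of \<open>cl S\<close> that extended a maximal independent subset of
  \<open>S\<close> would raise the rank of \<open>S\<close>.\<close>

lemma rk_mcl: "rk (cl S) = rk S"
proof (rule antisym)
  obtain I where I: "I \<subseteq> S" "indep I" "card I = rk S" by (rule rk_attained)
  obtain J where J: "I \<subseteq> J" "J \<subseteq> cl S" "indep J" "card J = rk (cl S)"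
    using extend_to_rk[OF I(2), of "cl S"] I(1) mcl_subset by blast
  have "e \<in> I" if "e \<in> J" for e
  proof (rule ccontr)
    assume "e \<notin> I"
    then have "card (insert e I) = Suc (rk S)" using I(3) by simp
    moreover have "card (insert e I) \<le> rk (insert e S)"
      using that J(1) I(1) by (intro card_le_rk) (auto intro: indep_subset[OF J(3)])
    moreover have "rk (insert e S) = rk S" using that J(2) unfolding mcl_def by auto
    ultimately show False by simp
  qed
  then have "J = I" using J(1) by blast
  then show "rk (cl S) \<le> rk S" using I(3) J(4) by simp
qed (simp add: rk_mono mcl_subset)

lemma mem_flat_iff: "mflat indep G \<Longrightarrow> e \<in> G \<longleftrightarrow> rk (insert e G) = rk G"
  unfolding mflat_def mcl_def by blast

lemma mflat_mcl: "mflat indep (cl S)"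
  unfolding mflat_def
proof (rule antisym[OF _ mcl_subset], rule subsetI)
  fix e assume "e \<in> cl (cl S)"
  then have "rk (insert e (cl S)) = rk S" using rk_mcl[of S] unfolding mcl_def[of _ "cl S"] by simp
  then have "rk (insert e S) \<le> rk S"
    using rk_mono[of "insert e S" "insert e (cl S)"] mcl_subset by (metis insert_mono)
  then show "e \<in> cl S" unfolding mcl_def using rk_mono[OF subset_insertI, of S e] by simp
qed

lemma flat_rk_subset:
  assumes "mflat indep G" "G \<subseteq> H" "rk H \<le> rk G"
  shows "H \<subseteq> G"
proof
  fix e assume "e \<in> H"
  then have "rk (insert e G) \<le> rk G" using rk_mono[of "insert e G" H] assms by auto
  then show "e \<in> G" using mem_flat_iff[OF assms(1)] rk_mono[OF subset_insertI, of G e] by simp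
qed

text \<open>Submodularity for \<open>G\<close> and \<open>cl S\<close> bounds the rank of their
  union by that of \<open>G\<close>, and a flat cannot grow without raising its rank.\<close>

lemma mcl_least:
  assumes "mflat indep G" "S \<subseteq> G"
  shows "cl S \<subseteq> G"
proof -
  have "rk (G \<union> cl S) + rk (G \<inter> cl S) \<le> rk G + rk S" using rk_submodular[of G "cl S"] rk_mcl by simp
  moreover have "rk S \<le> rk (G \<inter> cl S)" using assms(2) mcl_subset by (intro rk_mono) blast
  ultimately have "G \<union> cl S \<subseteq> G" by (intro flat_rk_subset[OF assms(1)]) auto
  then show ?thesis by blast
qed

lemma mcl_mono: "S \<subseteq> T \<Longrightarrow> cl S \<subseteq> cl T"
  using mcl_least[OF mflat_mcl] mcl_subset by blast

lemma mem_mcl_iff_dependent: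
  assumes "indep X" "e \<notin> X"
  shows "e \<in> cl X \<longleftrightarrow> \<not> indep (insert e X)"
proof
  assume "e \<in> cl X"
  then have "rk (insert e X) = card X" using rk_indep[OF assms(1)] unfolding mcl_def by simp
  then show "\<not> indep (insert e X)" using rk_indep[of "insert e X"] assms(2) by auto
next
  assume *: "\<not> indep (insert e X)"
  have "rk (insert e X) \<le> card X"
  proof (rule ccontr)
    assume "\<not> ?thesis"
    then have "card (insert e X) \<le> rk (insert e X)" using assms(2) by simp
    then obtain Y where "Y \<subseteq> insert e X" "indep Y" "card (insert e X) \<le> card Y"
      by (metis rk_attained)
    then show False using * card_seteq[of "insert e X" Y] by simp
  qed
  then show "e \<in> cl X" unfolding mcl_def
    using rk_indep[OF assms(1)] rk_mono[OF subset_insertI, of X e] by simp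
qed

section \<open>Ordered bases and the level sets of \<open>apartment_map\<close>\<close>

lemma indep_basis_image: "ordered_basis indep b \<Longrightarrow> indep (b ` A)"
  unfolding ordered_basis_def mbasis_def by (blast intro: indep_subset)

lemma rk_basis_image: "ordered_basis indep b \<Longrightarrow> rk (b ` A) = card A"
  using rk_indep[OF indep_basis_image]
  by (metis card_image inj_on_subset ordered_basis_def subset_UNIV)

lemma basis_mem_mcl_iff:
  assumes "ordered_basis indep b"
  shows "b k \<in> cl (b ` A) \<longleftrightarrow> k \<in> A"
proof -
  have inj: "inj b" using assms unfolding ordered_basis_def by simp
  have "b k \<in> b ` A" if "b k \<in> cl (b ` A)"
    using mem_mcl_iff_dependent[OF indep_basis_image[OF assms, of A], of "b k"]
      indep_basis_image[OF assms, of "insert k A"] that by auto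
  then show ?thesis using mcl_subset inj_image_mem_iff[OF inj] by blast
qed

lemma mcl_basis:
  assumes "ordered_basis indep b" shows "cl (range b) = UNIV"
proof -
  have "e \<in> cl (range b)" for e
  proof (cases "e \<in> range b")
    case False
    then show ?thesis using assms mem_mcl_iff_dependent[OF indep_basis_image[OF assms, of UNIV]]
      unfolding ordered_basis_def mbasis_def by blast
  qed (use mcl_subset in blast)
  then show ?thesis by blast
qed

text \<open>Let \<open>X\<close> be the set of basis elements of weight at least \<open>t\<close>.
  For \<open>e\<close> outside the basis, the minimum is at least \<open>t\<close> exactly when the
  fundamental circuit lies in \<open>insert e X\<close>, which by its uniqueness means that
  \<open>e\<close> depends on \<open>X\<close>.\<close>

lemma apartment_map_ge_iff:
  assumes "loopless indep" and b: "ordered_basis indep b"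
  shows "t \<le> apartment_map indep b w $ e \<longleftrightarrow> e \<in> cl (b ` {j. t \<le> w $ j})"
proof (cases "e \<in> range b")
  case True
  then obtain k where "e = b k" by blast
  then show ?thesis
    using apartment_map_basis[of b indep w k] basis_mem_mcl_iff[OF b] b
    unfolding ordered_basis_def by simp
next
  case e: False
  let ?X = "b ` {j. t \<le> w $ j}" and ?C = "fund_circuit indep (range b) e"
  have bb: "inj b" "mbasis indep (range b)" using b unfolding ordered_basis_def by auto
  note C = fund_circuit[OF matroid bb(2) e]
  have ne: "?C - {e} \<noteq> {}" using fund_circuit_nonempty[OF matroid assms(1) bb(2) e] .
  have "t \<le> apartment_map indep b w $ e \<longleftrightarrow> (\<forall>x\<in>?C - {e}. t \<le> w $ inv b x)"
    using e ne by (simp add: apartment_map_def)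
  also have "\<dots> \<longleftrightarrow> ?C \<subseteq> insert e ?X"
  proof -
    have "x \<in> ?X \<longleftrightarrow> t \<le> w $ inv b x" if x: "x \<in> ?C - {e}" for x
    proof -
      obtain k where "x = b k" using C(2) x by blast
      then show ?thesis using bb(1) by (auto simp: inj_def)
    qed
    then show ?thesis by blast
  qed
  also have "\<dots> \<longleftrightarrow> \<not> indep (insert e ?X)"
  proof
    assume "?C \<subseteq> insert e ?X"
    then show "\<not> indep (insert e ?X)" using C(1) indep_subset unfolding mcircuit_def by blast
  next
    assume "\<not> indep (insert e ?X)"
    then obtain D where D: "D \<subseteq> insert e ?X" "mcircuit indep D" using ex_mcircuit by blast
    then have "D \<subseteq> insert e (range b)" by blast
    then show "?C \<subseteq> insert e ?X"
      using ex1_fund_circuit[OF matroid bb(2) e] D C by blast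
  qed
  also have "\<dots> \<longleftrightarrow> e \<in> cl ?X"
    using mem_mcl_iff_dependent[OF indep_basis_image[OF b], of e] e by blast
  finally show ?thesis .
qed

end

section \<open>Regions of a rank-preserving map into the flats\<close>

lemma ind_vec_nth: "ind_vec A $ i = (if i \<in> A then 1 else 0)"
  by (simp add: ind_vec_def axis_def)

text \<open>Ties in \<open>y\<close> are broken by \<open>g\<close>, and \<open>w\<close> counts the
  predecessors in the resulting linear order. So \<open>w\<close> lies in an open chamber whose
  closure contains \<open>y\<close>.\<close>

lemma exists_injective_refinement:
  fixes y g :: "real^'r::finite"
  assumes "inj (($) g)"
  obtains w :: "real^'r" where "inj (($) w)"
    and "\<And>i j. w $ i \<le> w $ j \<longleftrightarrow> y $ i < y $ j \<or> y $ i = y $ j \<and> g $ i \<le> g $ j"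
proof -
  define lt where "lt j i \<longleftrightarrow> y $ j < y $ i \<or> y $ j = y $ i \<and> g $ j < g $ i" for j i
  define w :: "real^'r" where "w = (\<chi> i. real (card {j. lt j i}))"
  have less: "w $ i < w $ j" if "lt i j" for i j
  proof -
    have "{k. lt k i} \<subset> {k. lt k j}" using that unfolding lt_def by fastforce
    then show ?thesis unfolding w_def by (simp add: psubset_card_mono)
  qed
  have tot: "lt i j \<or> lt j i" if "i \<noteq> j" for i j
  proof -
    have "g $ i \<noteq> g $ j" using assms that by (auto dest: injD)
    then show ?thesis unfolding lt_def by linarith
  qed
  show thesis
  proof (rule that)
    show "inj (($) w)" using less tot by (metis injI less_irrefl)
    show "w $ i \<le> w $ j \<longleftrightarrow> y $ i < y $ j \<or> y $ i = y $ j \<and> g $ i \<le> g $ j" for i j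
    proof (cases "i = j")
      case False
      then have "g $ i \<noteq> g $ j" using assms by (auto dest: injD)
      then have "(y $ i < y $ j \<or> y $ i = y $ j \<and> g $ i \<le> g $ j) \<longleftrightarrow> lt i j"
        unfolding lt_def by auto
      moreover have "lt i j \<longleftrightarrow> w $ i \<le> w $ j" using less tot[OF False] by force
      ultimately show ?thesis by simp
    qed simp
  qed
qed

lemma ex_superlevel_eq:
  fixes y :: "real^'r::finite"
  shows "\<exists>u. {i. t < y $ i} = {i. u \<le> y $ i}"
proof (cases "{i. t < y $ i} = {}")
  case True
  then have "y $ i < t + 1" for i by (simp add: not_less le_less_trans[of _ t])
  then have "{i. t < y $ i} = {i. t + 1 \<le> y $ i}" using True by (simp add: not_le[symmetric])
  then show ?thesis by blast
next
  case False
  define u where "u = Min ((($) y) ` {i. t < y $ i})"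
  have "t < u" unfolding u_def using False by (subst Min_gr_iff) auto
  moreover have "u \<le> y $ i" if "t < y $ i" for i unfolding u_def using that by (intro Min_le) auto
  ultimately show ?thesis by (auto intro: less_le_trans intro!: exI[of _ u])
qed

lemma ex_injective_vector: obtains g :: "real^'r::finite" where "inj (($) g)"
proof -
  obtain h :: "'r \<Rightarrow> nat" where h: "inj h"
    using finite_imp_inj_to_nat_seg[of "UNIV :: 'r set"] by auto
  have "inj (($) (\<chi> i. real (h i)))" using h by (auto simp: inj_def)
  then show thesis by (rule that)
qed

text \<open>The construction of the fan depends on the bundle only through these properties. They
  say that \<open>F\<close> sends each maximal chain of index sets to a complete flag of flats, so
  every open chamber carries a complete flag.\<close>

locale flat_map = matroid_on indep for indep :: "'e::finite set \<Rightarrow> bool" +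
  fixes F :: "'r::finite set \<Rightarrow> 'e set"
  assumes flat: "mflat indep (F A)"
    and mono: "A \<subseteq> B \<Longrightarrow> F A \<subseteq> F B"
    and total: "F UNIV = UNIV"
    and rk: "rk (F A) = card A"
begin

text \<open>For \<open>w\<close> with distinct coordinates this is the largest of the lattices
  \<open>{A. b ` A \<subseteq> F A}\<close>, over ordered bases \<open>b\<close>, that contain the superlevel sets of \<open>w\<close>.\<close>

definition upsets :: "real^'r \<Rightarrow> 'r set set" where
  "upsets w = {A. \<forall>k\<in>A. \<not> F (A \<inter> {i. w $ k \<le> w $ i}) \<subseteq> F {i. w $ k < w $ i}}"

text \<open>Membership depends only on the chain of superlevel sets and persists when the chain
  shrinks. So this is a union of closed cells of the braid arrangement, before division by
  \<open>1\<close>.\<close>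

definition region :: "real^'r \<Rightarrow> (real^'r) set" where
  "region w = {y. \<forall>t. {i. t \<le> y $ i} \<in> upsets w}"

text \<open>For an ordered basis \<open>b\<close> these are the points where \<open>b\<close> is
  adapted to the flats: by rank, the image of each superlevel set \<open>A\<close> spans
  \<open>F A\<close>.\<close>

definition apartment_region :: "('r \<Rightarrow> 'e) \<Rightarrow> (real^'r) set" where
  "apartment_region b = {y. \<forall>t. b ` {i. t \<le> y $ i} \<subseteq> F {i. t \<le> y $ i}}"

section \<open>The lattice property of \<open>upsets\<close>\<close>

lemma not_subset_of_card_less: "card B < card A \<Longrightarrow> \<not> F A \<subseteq> F B"
  using rk_mono[of "F A" "F B"] rk by auto

lemma upsetsD:
  "A \<in> upsets w \<Longrightarrow> k \<in> A \<Longrightarrow> \<not> F (A \<inter> {i. w $ k \<le> w $ i}) \<subseteq> F {i. w $ k < w $ i}"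
  unfolding upsets_def by blast

lemma upsets_Un:
  assumes "A \<in> upsets w" "B \<in> upsets w" shows "A \<union> B \<in> upsets w"
  unfolding upsets_def mem_Collect_eq
proof
  fix k assume "k \<in> A \<union> B"
  then obtain C where C: "C \<in> upsets w" "k \<in> C" "C \<subseteq> A \<union> B" using assms by blast
  have "F (C \<inter> {i. w $ k \<le> w $ i}) \<subseteq> F ((A \<union> B) \<inter> {i. w $ k \<le> w $ i})"
    using C(3) by (intro mono) blast
  then show "\<not> F ((A \<union> B) \<inter> {i. w $ k \<le> w $ i}) \<subseteq> F {i. w $ k < w $ i}"
    using upsetsD[OF C(1,2)] by blast
qed

text \<open>The condition at \<open>k\<close> sees only the indices of weight at least
  \<open>w $ k\<close>, and a truncation that keeps \<open>k\<close> keeps all of these.\<close>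

lemma upsets_truncate:
  assumes "A \<in> upsets w"
  shows "A \<inter> {i. t \<le> w $ i} \<in> upsets w" "A \<inter> {i. t < w $ i} \<in> upsets w"
proof -
  have *: "\<not> F (A' \<inter> {i. w $ k \<le> w $ i}) \<subseteq> F {i. w $ k < w $ i}"
    if "k \<in> A" "A \<inter> {i. w $ k \<le> w $ i} = A' \<inter> {i. w $ k \<le> w $ i}" for k A'
    using upsetsD[OF assms that(1)] unfolding that(2) .
  show "A \<inter> {i. t \<le> w $ i} \<in> upsets w" "A \<inter> {i. t < w $ i} \<in> upsets w"
    unfolding upsets_def mem_Collect_eq by (intro ballI *; auto)+
qed

lemma upset_in_upsets:
  assumes "\<And>i k. k \<in> A \<Longrightarrow> w $ k \<le> w $ i \<Longrightarrow> i \<in> A"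
  shows "A \<in> upsets w"
  unfolding upsets_def
proof safe
  fix k assume k: "k \<in> A" "F (A \<inter> {i. w $ k \<le> w $ i}) \<subseteq> F {i. w $ k < w $ i}"
  have "{i. w $ k < w $ i} \<subset> A \<inter> {i. w $ k \<le> w $ i}" using assms[OF k(1)] k(1) by fastforce
  then have "card {i. w $ k < w $ i} < card (A \<inter> {i. w $ k \<le> w $ i})" by (simp add: psubset_card_mono)
  then show False using not_subset_of_card_less k(2) by blast
qed

lemma region_refined:
  assumes "\<And>i k. w $ k \<le> w $ i \<Longrightarrow> y $ k \<le> y $ i"
  shows "y \<in> region w"
  unfolding region_def using assms by (fastforce intro: upset_in_upsets)

text \<open>Induction that removes the index \<open>k\<close> of least weight from
  \<open>A \<union> B\<close>. Whichever set contains \<open>k\<close> has a flat not inside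
  \<open>F {i. w $ k < w $ i}\<close>, while both truncated flats are inside it; so restoring
  \<open>k\<close> raises the rank of the union.\<close>

lemma card_Un_le_rk:
  assumes w: "inj (($) w)" and A: "A \<in> upsets w" and B: "B \<in> upsets w"
  shows "card (A \<union> B) \<le> rk (F A \<union> F B)"
  using A B
proof (induction "card (A \<union> B)" arbitrary: A B)
  case (Suc n)
  define k where "k = arg_min_on (($) w) (A \<union> B)"
  have ne: "A \<union> B \<noteq> {}" using Suc.hyps(2) by auto
  have kAB: "k \<in> A \<union> B" unfolding k_def using arg_min_if_finite(1)[OF finite ne] .
  have kmin: "w $ k \<le> w $ i" if "i \<in> A \<union> B" for i
    unfolding k_def using arg_min_least[OF finite ne that] .
  have less: "w $ k < w $ i \<longleftrightarrow> i \<noteq> k" if "i \<in> A \<union> B" for i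
    using kmin[OF that] w by (auto simp: less_le dest: injD)
  let ?G = "F {i. w $ k < w $ i}"
  let ?A = "A \<inter> {i. w $ k < w $ i}" and ?B = "B \<inter> {i. w $ k < w $ i}"
  have AB: "?A = A - {k}" "?B = B - {k}" using less by auto
  then have "?A \<union> ?B = A \<union> B - {k}" by blast
  then have c: "card (A \<union> B) = Suc (card (?A \<union> ?B))" using card.remove[OF finite kAB] by simp
  have IH: "card (?A \<union> ?B) \<le> rk (F ?A \<union> F ?B)"
    using c Suc.hyps(2) upsets_truncate(2) Suc.prems by (intro Suc.hyps(1)) auto
  have eq: "A \<inter> {i. w $ k \<le> w $ i} = A" "B \<inter> {i. w $ k \<le> w $ i} = B" using kmin by auto
  have "\<not> F A \<subseteq> ?G \<or> \<not> F B \<subseteq> ?G"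
    using upsetsD[OF Suc.prems(1), of k] upsetsD[OF Suc.prems(2), of k] kAB unfolding eq by blast
  then obtain e where e: "e \<in> F A \<union> F B" "e \<notin> ?G" by blast
  have sub: "F ?A \<union> F ?B \<subseteq> ?G" using mono[of ?A "{i. w $ k < w $ i}"] mono[of ?B "{i. w $ k < w $ i}"] by blast
  have "e \<notin> cl (F ?A \<union> F ?B)" using mcl_least[OF flat sub] e(2) by blast
  then have "rk (F ?A \<union> F ?B) < rk (insert e (F ?A \<union> F ?B))"
    using rk_mono[OF subset_insertI, of "F ?A \<union> F ?B" e] unfolding mcl_def by auto
  also have "\<dots> \<le> rk (F A \<union> F B)"
    using e(1) mono[of ?A A] mono[of ?B B] by (intro rk_mono) blast
  finally show ?case using c IH by simp
qed simp

text \<open>Submodularity turns the lower bound on the join into an upper bound on the meet.\<close>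

lemma Int_eq:
  assumes "card (A \<union> B) \<le> rk (F A \<union> F B)"
  shows "F A \<inter> F B = F (A \<inter> B)"
proof
  have "card (A \<union> B) + rk (F A \<inter> F B) \<le> card A + card B"
    using rk_submodular[of "F A" "F B"] assms rk by simp
  then have "rk (F A \<inter> F B) \<le> card (A \<inter> B)" using card_Un_Int[of A B] by simp
  then show "F A \<inter> F B \<subseteq> F (A \<inter> B)"
    by (intro flat_rk_subset[OF flat]) (simp_all add: mono rk)
qed (simp add: mono)

text \<open>If the condition failed at \<open>k\<close>, the flat of
  \<open>A \<inter> B \<inter> ?I\<close> would lie in both \<open>F (A \<inter> ?H)\<close> and
  \<open>F (B \<inter> ?H)\<close>. These meet in \<open>F (A \<inter> B \<inter> ?H)\<close>, whose
  rank is too small because \<open>k\<close> is missing.\<close>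

lemma upsets_Int:
  assumes w: "inj (($) w)" and A: "A \<in> upsets w" and B: "B \<in> upsets w"
  shows "A \<inter> B \<in> upsets w"
  unfolding upsets_def
proof safe
  fix k assume k: "k \<in> A" "k \<in> B"
    and sub: "F (A \<inter> B \<inter> {i. w $ k \<le> w $ i}) \<subseteq> F {i. w $ k < w $ i}"
  let ?H = "{i. w $ k < w $ i}" and ?I = "{i. w $ k \<le> w $ i}"
  \<comment> \<open>The left side is a flat properly inside \<open>F (C \<inter> ?I)\<close>, whose
    rank exceeds that of \<open>F (C \<inter> ?H)\<close> by one.\<close>
  have strip: "F (C \<inter> ?I) \<inter> F ?H \<subseteq> F (C \<inter> ?H)" if "C \<in> upsets w" "k \<in> C" for C
  proof (rule flat_rk_subset[OF flat])
    show "F (C \<inter> ?H) \<subseteq> F (C \<inter> ?I) \<inter> F ?H" by (intro Int_greatest mono) auto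
    have "\<not> F (C \<inter> ?I) \<subseteq> F (C \<inter> ?I) \<inter> F ?H" using that unfolding upsets_def by blast
    moreover have "mflat indep (F (C \<inter> ?I) \<inter> F ?H)"
      unfolding mflat_def using mcl_subset mcl_least[OF flat]
      by (intro equalityI Int_greatest) auto
    ultimately have "\<not> rk (F (C \<inter> ?I)) \<le> rk (F (C \<inter> ?I) \<inter> F ?H)"
      using flat_rk_subset[of "F (C \<inter> ?I) \<inter> F ?H" "F (C \<inter> ?I)"] by blast
    moreover have "C \<inter> ?I = insert k (C \<inter> ?H)" using that(2) w by (auto simp: less_le dest: injD)
    ultimately show "rk (F (C \<inter> ?I) \<inter> F ?H) \<le> rk (F (C \<inter> ?H))" by (simp add: rk)
  qed
  have "F (A \<inter> B \<inter> ?I) \<subseteq> F (A \<inter> ?I) \<inter> F ?H" "F (A \<inter> B \<inter> ?I) \<subseteq> F (B \<inter> ?I) \<inter> F ?H"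
    using sub mono[of "A \<inter> B \<inter> ?I" "A \<inter> ?I"] mono[of "A \<inter> B \<inter> ?I" "B \<inter> ?I"] by auto
  then have "F (A \<inter> B \<inter> ?I) \<subseteq> F (A \<inter> ?H) \<inter> F (B \<inter> ?H)"
    using strip[OF A k(1)] strip[OF B k(2)] by blast
  also have "\<dots> = F ((A \<inter> ?H) \<inter> (B \<inter> ?H))"
    using upsets_truncate(2)[OF A] upsets_truncate(2)[OF B] by (intro Int_eq card_Un_le_rk[OF w]) auto
  finally have "F (A \<inter> B \<inter> ?I) \<subseteq> F ((A \<inter> ?H) \<inter> (B \<inter> ?H))" .
  moreover have "(A \<inter> ?H) \<inter> (B \<inter> ?H) \<subset> A \<inter> B \<inter> ?I" using k by auto
  then have "card ((A \<inter> ?H) \<inter> (B \<inter> ?H)) < card (A \<inter> B \<inter> ?I)" by (simp add: psubset_card_mono)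
  ultimately show False using not_subset_of_card_less by blast
qed

lemma upsets_empty: "{} \<in> upsets w" and upsets_UNIV: "UNIV \<in> upsets w"
  by (auto intro: upset_in_upsets)

lemma upsets_Union:
  assumes "finite \<A>" "\<A> \<subseteq> upsets w" shows "\<Union>\<A> \<in> upsets w"
  using assms by (induction \<A>) (auto intro: upsets_Un upsets_empty)

lemma upsets_Inter:
  assumes "inj (($) w)" "finite \<A>" "\<A> \<subseteq> upsets w" shows "\<Inter>\<A> \<in> upsets w"
  using assms(2,3) by (induction \<A>) (auto intro: upsets_Int[OF assms(1)] upsets_UNIV)

text \<open>The basis element for the coordinate \<open>k\<close> is taken in the flat of the least set
  of the lattice that contains \<open>k\<close>.\<close>

lemma ex_region_basis:
  assumes w: "inj (($) w)"
  obtains b where "ordered_basis indep b" "\<forall>A\<in>upsets w. b ` A \<subseteq> F A"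
proof -
  \<comment> \<open>The cut to weights at least \<open>w $ k\<close> serves injectivity: for
    \<open>w $ i < w $ j\<close> it puts \<open>b j\<close> into
    \<open>F {k. w $ i < w $ k}\<close>, which \<open>b i\<close> avoids.\<close>
  define D where "D k = \<Inter>{A \<in> upsets w. k \<in> A} \<inter> {i. w $ k \<le> w $ i}" for k
  have "\<exists>e. e \<in> F (D k) - F {i. w $ k < w $ i}" for k
  proof -
    have "\<Inter>{A \<in> upsets w. k \<in> A} \<in> upsets w" by (rule upsets_Inter[OF w]) auto
    then show ?thesis unfolding upsets_def D_def by blast
  qed
  then obtain b where b: "\<And>k. b k \<in> F (D k) - F {i. w $ k < w $ i}" by metis
  have sub: "b ` A \<subseteq> F A" if "A \<in> upsets w" for A
  proof safe
    fix k assume "k \<in> A"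
    then have "D k \<subseteq> A" using that unfolding D_def by blast
    then show "b k \<in> F A" using b mono by blast
  qed
  have inj: "inj b"
  proof (rule injI, rule ccontr)
    have *: False if "b i = b j" "w $ i < w $ j" for i j
    proof -
      have "b j \<in> F (D j)" using b by blast
      also have "\<dots> \<subseteq> F {k. w $ i < w $ k}" using that(2) unfolding D_def by (intro mono) auto
      finally show False using b[of i] that(1) by simp
    qed
    fix i j assume "b i = b j" "i \<noteq> j"
    moreover have "w $ i < w $ j \<or> w $ j < w $ i" using \<open>i \<noteq> j\<close> w by (metis injD linorder_neqE)
    ultimately show False using * by metis
  qed
  have ind: "indep (b ` A)" if "\<And>i k. k \<in> A \<Longrightarrow> w $ k \<le> w $ i \<Longrightarrow> i \<in> A" for A
    using that
  proof (induction "card A" arbitrary: A)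
    case 0
    then show ?case using matroid unfolding matroid_def by simp
  next
    case (Suc n)
    define k where "k = arg_min_on (($) w) A"
    have ne: "A \<noteq> {}" using Suc.hyps(2) by auto
    have kA: "k \<in> A" unfolding k_def using arg_min_if_finite(1)[OF finite ne] .
    have kmin: "w $ k \<le> w $ i" if "i \<in> A" for i
      unfolding k_def using arg_min_least[OF finite ne that] .
    have A: "{i. w $ k < w $ i} = A - {k}"
      using kmin Suc.prems[OF kA] w by (auto simp: less_le dest: injD)
    have "n = card {i. w $ k < w $ i}"
      using Suc.hyps(2) card.remove[OF finite kA] by (simp add: A)
    then have 1: "indep (b ` (A - {k}))"
      unfolding A[symmetric]
      by (intro Suc.hyps(1)) auto
    have "b ` (A - {k}) \<subseteq> F (A - {k})"
      unfolding A[symmetric] by (intro sub upset_in_upsets) auto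
    then have "cl (b ` (A - {k})) \<subseteq> F (A - {k})" by (intro mcl_least flat)
    then have "b k \<notin> cl (b ` (A - {k}))" using b[of k] unfolding A by blast
    moreover have "b k \<notin> b ` (A - {k})" using inj by (auto dest: injD)
    ultimately have "indep (insert (b k) (b ` (A - {k})))" using mem_mcl_iff_dependent[OF 1] by blast
    then show ?case using kA by (metis image_insert insert_Diff)
  qed
  have "indep (range b)" by (rule ind) simp
  moreover have "X = range b" if "indep X" "range b \<subseteq> X" for X
  proof -
    have "card X \<le> card (range b)"
      using card_le_rk[OF that(1) subset_UNIV] rk[of UNIV] card_image[OF inj] by (simp add: total)
    then show ?thesis using that card_seteq[of X "range b"] by auto
  qed
  ultimately have "ordered_basis indep b" using inj unfolding ordered_basis_def mbasis_def by blast
  then show thesis using that sub by blast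
qed


section \<open>Regions as convex cones\<close>

lemma superlevel_gt_in_upsets: "y \<in> region w \<Longrightarrow> {i. t < y $ i} \<in> upsets w"
  using ex_superlevel_eq[of t y] unfolding region_def by auto

lemma zero_in_region: "0 \<in> region w"
  by (rule region_refined) simp

lemma region_scaleR:
  assumes "y \<in> region w" "0 \<le> c" shows "c *\<^sub>R y \<in> region w"
proof (cases "c = 0")
  case False
  then have "{i. t \<le> (c *\<^sub>R y) $ i} = {i. t / c \<le> y $ i}" for t
    using assms(2) by (simp add: divide_le_eq mult.commute)
  then show ?thesis using assms(1) unfolding region_def by simp
qed (simp add: zero_in_region)

lemma region_add:
  assumes w: "inj (($) w)" and "x \<in> region w" "y \<in> region w" shows "x + y \<in> region w"
  unfolding region_def mem_Collect_eq
proof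
  fix t
  \<comment> \<open>Superlevel sets of a sum are unions of intersections of superlevel sets of the
    summands; \<open>k = i\<close> is the witness. Here the lattice property becomes
    convexity.\<close>
  have "{i. t \<le> (x + y) $ i} = \<Union>((\<lambda>k. {i. x $ k \<le> x $ i} \<inter> {i. t - x $ k \<le> y $ i}) ` UNIV)"
    by (auto simp: algebra_simps)
  also have "\<dots> \<in> upsets w"
    using assms(2,3) unfolding region_def by (intro upsets_Union) (auto intro: upsets_Int[OF w])
  finally show "{i. t \<le> (x + y) $ i} \<in> upsets w" .
qed

lemma region_shift_iff: "y + c *\<^sub>R 1 \<in> region w \<longleftrightarrow> y \<in> region w"
proof -
  have "{i. t \<le> (y + c *\<^sub>R 1) $ i} = {i. t - c \<le> y $ i}" for t by (auto simp: algebra_simps)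
  then have "y + c *\<^sub>R 1 \<in> region w \<longleftrightarrow> (\<forall>t. {i. t - c \<le> y $ i} \<in> upsets w)"
    unfolding region_def by simp
  also have "\<dots> \<longleftrightarrow> y \<in> region w"
    unfolding region_def mem_Collect_eq by (metis add_diff_cancel_right')
  finally show ?thesis .
qed

lemma convex_cone_region: "inj (($) w) \<Longrightarrow> convex_cone (region w)"
  unfolding convex_cone_iff using zero_in_region region_add region_scaleR by blast

lemma ind_vec_in_region:
  assumes "A \<in> upsets w" shows "ind_vec A \<in> region w"
proof -
  have "{i. t \<le> ind_vec A $ i} = (if t \<le> 0 then UNIV else if t \<le> 1 then A else {})" for t
    by (auto simp: ind_vec_nth)
  then show ?thesis using assms upsets_UNIV upsets_empty unfolding region_def by simp
qed

section \<open>Regions, apartments and common faces\<close>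

lemma F_eq_mcl:
  assumes "ordered_basis indep b" "b ` A \<subseteq> F A" shows "F A = cl (b ` A)"
proof
  show "cl (b ` A) \<subseteq> F A" using assms(2) by (intro mcl_least flat)
  show "F A \<subseteq> cl (b ` A)"
    using \<open>cl (b ` A) \<subseteq> F A\<close> by (intro flat_rk_subset[OF mflat_mcl]) (simp_all add: rk rk_mcl rk_basis_image assms(1))
qed

text \<open>This is the maximality of \<open>upsets w\<close>. If \<open>b\<close> spans
  \<open>F A\<close>, then independence of \<open>b\<close> gives \<open>Int_eq\<close> for
  \<open>A\<close> and \<open>?I\<close>, so \<open>b k\<close> lies in
  \<open>F (A \<inter> ?I)\<close>; but \<open>b k\<close> is outside the span of \<open>b\<close>
  on \<open>?H\<close>.\<close>

lemma apartment_region_subset_region: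
  assumes b: "ordered_basis indep b" and w: "w \<in> apartment_region b"
  shows "apartment_region b \<subseteq> region w"
proof -
  have "A \<in> upsets w" if A: "b ` A \<subseteq> F A" for A
    unfolding upsets_def
  proof safe
    fix k assume k: "k \<in> A" and sub: "F (A \<inter> {i. w $ k \<le> w $ i}) \<subseteq> F {i. w $ k < w $ i}"
    let ?I = "{i. w $ k \<le> w $ i}" and ?H = "{i. w $ k < w $ i}"
    have I: "b ` ?I \<subseteq> F ?I" using w unfolding apartment_region_def by blast
    have H: "b ` ?H \<subseteq> F ?H"
    proof -
      obtain u where "?H = {i. u \<le> w $ i}" using ex_superlevel_eq by blast
      then show ?thesis using w unfolding apartment_region_def by simp
    qed
    have "rk (b ` (A \<union> ?I)) \<le> rk (F A \<union> F ?I)" using A I by (intro rk_mono) blast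
    then have "F A \<inter> F ?I = F (A \<inter> ?I)" by (intro Int_eq) (simp add: rk_basis_image b)
    then have "b k \<in> F (A \<inter> ?I)" using A I k by blast
    then have "b k \<in> cl (b ` ?H)" using sub F_eq_mcl[OF b H] by blast
    then show False using basis_mem_mcl_iff[OF b] by simp
  qed
  then show ?thesis unfolding apartment_region_def region_def by blast
qed

lemma ex_region_apartment:
  assumes w: "inj (($) w)"
  obtains b where "ordered_basis indep b" "region w \<subseteq> apartment_region b"
proof -
  obtain b where "ordered_basis indep b" "\<forall>A\<in>upsets w. b ` A \<subseteq> F A"
    using ex_region_basis[OF w] .
  then show thesis by (intro that) (auto simp: region_def apartment_region_def image_subset_iff)
qed

text \<open>Some apartment covers \<open>region w\<close>, hence contains \<open>w'\<close>, and
  maximality at \<open>w'\<close> absorbs the whole apartment.\<close>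

lemma region_subset_region:
  assumes "inj (($) w)" "w' \<in> region w" shows "region w \<subseteq> region w'"
proof -
  obtain b where b: "ordered_basis indep b" "region w \<subseteq> apartment_region b"
    using ex_region_apartment[OF assms(1)] .
  then have "apartment_region b \<subseteq> region w'" using assms(2) by (intro apartment_region_subset_region) auto
  then show ?thesis using b(2) by simp
qed

lemma self_in_region: "w \<in> region w" by (rule region_refined) simp

lemma region_eq:
  assumes "inj (($) w)" "inj (($) w')" "w' \<in> region w" shows "region w' = region w"
  using region_subset_region[OF assms(1,3)] region_subset_region[OF assms(2), of w] self_in_region by auto

text \<open>Shrinking one member of a union lowers the rank of the union by at most the loss of rank
  in that member. This is applied first to \<open>G\<close>, then to \<open>H\<close>.\<close>

lemma rk_Un_ge_of_subsets:
  assumes "P \<subseteq> G" "Q \<subseteq> H"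
  shows "rk (G \<union> H) + rk P + rk Q \<le> rk (P \<union> Q) + rk G + rk H"
proof -
  have "rk (G \<union> H) + rk P \<le> rk (P \<union> H) + rk G"
  proof -
    have "rk ((P \<union> H) \<union> G) + rk ((P \<union> H) \<inter> G) \<le> rk (P \<union> H) + rk G" by (rule rk_submodular)
    moreover have "(P \<union> H) \<union> G = G \<union> H" using assms(1) by blast
    moreover have "rk P \<le> rk ((P \<union> H) \<inter> G)" using assms(1) by (intro rk_mono) blast
    ultimately show ?thesis by simp
  qed
  moreover have "rk (P \<union> H) + rk Q \<le> rk (P \<union> Q) + rk H"
  proof -
    have "rk ((P \<union> Q) \<union> H) + rk ((P \<union> Q) \<inter> H) \<le> rk (P \<union> Q) + rk H" by (rule rk_submodular)
    moreover have "(P \<union> Q) \<union> H = P \<union> H" using assms(2) by blast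
    moreover have "rk Q \<le> rk ((P \<union> Q) \<inter> H)" using assms(2) by (intro rk_mono) blast
    ultimately show ?thesis by simp
  qed
  ultimately show ?thesis by simp
qed

text \<open>With \<open>A\<close> a superlevel set of \<open>p\<close>, the part of \<open>A\<close> in a block
  \<open>K\<close> of \<open>m\<close> and its complement in \<open>K\<close> are cut out by superlevel sets of \<open>p\<close> and \<open>q\<close>,
  because \<open>p\<close> and \<open>q\<close> vary in opposite directions on \<open>K\<close>. So both parts are spanned by
  one basis, and this forces ranks to add up.\<close>

lemma region_face_aux:
  assumes w: "inj (($) w)" and w': "inj (($) w')"
    and p: "p \<in> region w" and q: "q \<in> region w"
    and m: "m = (1 - s) *\<^sub>R p + s *\<^sub>R q" "0 < s" "s < 1"
    and mw: "m \<in> region w"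
    and ref: "\<And>i k. w' $ k \<le> w' $ i \<Longrightarrow> m $ k \<le> m $ i"
  shows "p \<in> region w'"
  unfolding region_def mem_Collect_eq
proof
  fix t
  let ?A = "{i. t \<le> p $ i}"
  have A: "?A \<in> upsets w" using p unfolding region_def by blast
  show "?A \<in> upsets w'"
    unfolding upsets_def
  proof safe
    fix k assume k: "t \<le> p $ k"
      and sub: "F (?A \<inter> {i. w' $ k \<le> w' $ i}) \<subseteq> F {i. w' $ k < w' $ i}"
    let ?S = "{i. m $ k < m $ i}" and ?T = "{i. m $ k \<le> m $ i}"
    let ?C = "?S \<union> (?T - ?A)" and ?P = "?A \<inter> {i. w' $ k \<le> w' $ i}"
    let ?Q = "?S \<union> ((?T - ?A) \<inter> {i. w' $ k < w' $ i})"
    have C: "?C \<in> upsets w"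
    proof -
      \<comment> \<open>On the block where \<open>m $ i = m $ k\<close>, the equation for
        \<open>m\<close> makes \<open>p $ i < t\<close> equivalent to
        \<open>z < q $ i\<close>.\<close>
      define z where "z = (m $ k - (1 - s) * t) / s"
      have "i \<notin> ?A \<longleftrightarrow> z < q $ i" if "m $ i = m $ k" for i
      proof -
        have "m $ k = (1 - s) * p $ i + s * q $ i" using that m(1) by simp
        then have "z < q $ i \<longleftrightarrow> (1 - s) * p $ i < (1 - s) * t"
          using m(2) unfolding z_def by (simp add: divide_less_eq mult.commute)
        then show ?thesis using m(3) by (simp add: not_le)
      qed
      then have "i \<in> ?C \<longleftrightarrow> i \<in> ?S \<union> (?T \<inter> {i. z < q $ i})" for i
        by (cases "m $ i = m $ k") auto
      then have "?C = ?S \<union> (?T \<inter> {i. z < q $ i})" by blast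
      then show ?thesis using superlevel_gt_in_upsets[OF q] superlevel_gt_in_upsets[OF mw] mw
        unfolding region_def by (auto intro!: upsets_Un upsets_Int[OF w])
    qed
    have less: "w' $ k < w' $ i" if "m $ k < m $ i" for i
      using ref[of i k] that by force
    \<comment> \<open>The count for \<open>?A\<close> and \<open>?C\<close> passes to the smaller
      sets \<open>?P\<close> and \<open>?Q\<close>, which have the same intersection. Then
      \<open>F ?P\<close> and \<open>F ?Q\<close> together would have rank at least
      \<open>card (?P \<union> ?Q)\<close>, although both lie in the flat of the strictly smaller
      set \<open>{i. w' $ k < w' $ i}\<close>.\<close>
    have "rk (F ?A \<union> F ?C) + rk (F ?P) + rk (F ?Q) \<le> rk (F ?P \<union> F ?Q) + rk (F ?A) + rk (F ?C)"
      by (intro rk_Un_ge_of_subsets mono) auto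
    moreover have "card (?A \<union> ?C) \<le> rk (F ?A \<union> F ?C)" by (rule card_Un_le_rk[OF w A C])
    moreover have "card ?A + card ?C = card (?A \<union> ?C) + card (?A \<inter> ?C)" by (rule card_Un_Int) simp_all
    moreover have "card ?P + card ?Q = card (?P \<union> ?Q) + card (?P \<inter> ?Q)" by (rule card_Un_Int) simp_all
    moreover have "?P \<inter> ?Q = ?A \<inter> ?C" using less by (auto dest: less_imp_le)
    ultimately have "card (?P \<union> ?Q) \<le> rk (F ?P \<union> F ?Q)" by (simp add: rk)
    also have "\<dots> \<le> rk (F {i. w' $ k < w' $ i})"
      using sub mono[of ?Q "{i. w' $ k < w' $ i}"] less by (intro rk_mono) auto
    also have "\<dots> = card {i. w' $ k < w' $ i}" by (rule rk)
    also have "\<dots> < card (?P \<union> ?Q)"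
    proof (intro psubset_card_mono psubsetI)
      show "{i. w' $ k < w' $ i} \<subseteq> ?P \<union> ?Q" using ref by (auto simp: less_imp_le)
      show "{i. w' $ k < w' $ i} \<noteq> ?P \<union> ?Q" using k by auto
    qed simp
    finally show False by simp
  qed
qed

text \<open>The vector \<open>v\<close> refines \<open>m\<close>, with ties broken by
  \<open>w'\<close>. Its superlevel sets are lattice combinations of those of \<open>m\<close> and
  \<open>w'\<close>, so \<open>v\<close> defines the same region as \<open>w'\<close> and may
  replace it in \<open>region_face_aux\<close>.\<close>

lemma region_face:
  assumes w: "inj (($) w)" and w': "inj (($) w')"
    and p: "p \<in> region w" and q: "q \<in> region w"
    and m: "m = (1 - s) *\<^sub>R p + s *\<^sub>R q" "0 < s" "s < 1"
    and mw': "m \<in> region w'"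
  shows "p \<in> region w' \<and> q \<in> region w'"
proof -
  obtain v :: "real^'r" where v: "inj (($) v)"
    and le: "\<And>i j. v $ i \<le> v $ j \<longleftrightarrow> m $ i < m $ j \<or> m $ i = m $ j \<and> w' $ i \<le> w' $ j"
    using exists_injective_refinement[OF w'] by metis
  have "v \<in> region w'"
    unfolding region_def mem_Collect_eq
  proof
    fix t
    have up: "{i. v $ k \<le> v $ i} \<in> upsets w'" for k
    proof -
      have "{i. v $ k \<le> v $ i} = {i. m $ k < m $ i} \<union> ({i. m $ k \<le> m $ i} \<inter> {i. w' $ k \<le> w' $ i})"
        unfolding le by auto
      then show ?thesis
        using superlevel_gt_in_upsets[OF mw'] mw' self_in_region[of w'] unfolding region_def
        by (auto intro!: upsets_Un upsets_Int[OF w'])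
    qed
    have "{i. t \<le> v $ i} = \<Union>((\<lambda>k. {i. v $ k \<le> v $ i}) ` {k. t \<le> v $ k})" by (auto intro: order_trans)
    also have "\<dots> \<in> upsets w'" using up by (intro upsets_Union) auto
    finally show "{i. t \<le> v $ i} \<in> upsets w'" .
  qed
  then have eq: "region v = region w'" by (rule region_eq[OF w' v])
  have ref: "m $ k \<le> m $ i" if "v $ k \<le> v $ i" for i k using that le by auto
  have mw: "m \<in> region w"
    unfolding m(1) using m(2,3) p q by (intro region_add[OF w] region_scaleR) auto
  have m': "m = (1 - (1 - s)) *\<^sub>R q + (1 - s) *\<^sub>R p" "0 < 1 - s" "1 - s < 1" using m by simp_all
  show ?thesis
    using region_face_aux[OF w v p q m mw ref] region_face_aux[OF w v q p m' mw ref] eq by simp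
qed

end

section \<open>Rational cones and their faces\<close>

lemma convex_cone_sum:
  assumes "convex_cone C" "\<And>s. s \<in> S \<Longrightarrow> 0 \<le> c s" "\<And>s. s \<in> S \<Longrightarrow> 0 < c s \<Longrightarrow> s \<in> C"
  shows "(\<Sum>s\<in>S. c s *\<^sub>R s) \<in> C"
  using assms(2,3)
proof (induction S rule: infinite_finite_induct)
  case (insert s S)
  have "c s *\<^sub>R s \<in> C"
  proof (cases "c s = 0")
    case False
    then have "0 < c s" using insert.prems(1)[of s] by simp
    then show ?thesis using insert.prems(2)[of s] convex_cone_scaleR[OF assms(1)] by simp
  qed (simp add: convex_cone_contains_0[OF assms(1)])
  moreover have "(\<Sum>s\<in>S. c s *\<^sub>R s) \<in> C" using insert by simp
  ultimately show ?case using insert.hyps convex_cone_add[OF assms(1)] by simp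
qed (simp_all add: convex_cone_contains_0[OF assms(1)])

lemma convex_cone_hull_explicit:
  assumes "finite S"
  shows "convex_cone hull S = {\<Sum>s\<in>S. c s *\<^sub>R s | c. \<forall>s\<in>S. 0 \<le> c s}"
proof
  show "{\<Sum>s\<in>S. c s *\<^sub>R s | c. \<forall>s\<in>S. 0 \<le> c s} \<subseteq> convex_cone hull S"
    using convex_cone_sum[OF convex_cone_convex_cone_hull[of S]] hull_inc[of _ S convex_cone] by auto
  show "convex_cone hull S \<subseteq> {\<Sum>s\<in>S. c s *\<^sub>R s | c. \<forall>s\<in>S. 0 \<le> c s}"
  proof (rule hull_minimal)
    show "S \<subseteq> {\<Sum>s\<in>S. c s *\<^sub>R s | c. \<forall>s\<in>S. 0 \<le> c s}"
    proof
      fix x assume "x \<in> S"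
      then have "x = (\<Sum>s\<in>S. (if s = x then 1 else 0) *\<^sub>R s)"
        using assms by (simp add: if_distrib[of "\<lambda>c. c *\<^sub>R _"] cong: if_cong)
      then show "x \<in> {\<Sum>s\<in>S. c s *\<^sub>R s | c. \<forall>s\<in>S. 0 \<le> c s}"
        by (intro CollectI exI[of _ "\<lambda>s. if s = x then 1 else 0"]) auto
    qed
    show "convex_cone {\<Sum>s\<in>S. c s *\<^sub>R s | c. \<forall>s\<in>S. 0 \<le> c s}"
      unfolding convex_cone_iff
    proof (intro conjI ballI allI impI)
      show "0 \<in> {\<Sum>s\<in>S. c s *\<^sub>R s | c. \<forall>s\<in>S. 0 \<le> c s}"
        by (intro CollectI exI[of _ "\<lambda>s. 0"]) auto
    next
      fix x y
      assume "x \<in> {\<Sum>s\<in>S. c s *\<^sub>R s | c. \<forall>s\<in>S. 0 \<le> c s}" "y \<in> {\<Sum>s\<in>S. c s *\<^sub>R s | c. \<forall>s\<in>S. 0 \<le> c s}"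
      then obtain c d where "x = (\<Sum>s\<in>S. c s *\<^sub>R s)" "\<forall>s\<in>S. 0 \<le> c s"
        "y = (\<Sum>s\<in>S. d s *\<^sub>R s)" "\<forall>s\<in>S. 0 \<le> d s" by auto
      then show "x + y \<in> {\<Sum>s\<in>S. c s *\<^sub>R s | c. \<forall>s\<in>S. 0 \<le> c s}"
        by (intro CollectI exI[of _ "\<lambda>s. c s + d s"]) (auto simp: sum.distrib scaleR_left.add)
    next
      fix x and a :: real
      assume "x \<in> {\<Sum>s\<in>S. c s *\<^sub>R s | c. \<forall>s\<in>S. 0 \<le> c s}" "0 \<le> a"
      then obtain c where "x = (\<Sum>s\<in>S. c s *\<^sub>R s)" "\<forall>s\<in>S. 0 \<le> c s" by auto
      then show "a *\<^sub>R x \<in> {\<Sum>s\<in>S. c s *\<^sub>R s | c. \<forall>s\<in>S. 0 \<le> c s}"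
        using \<open>0 \<le> a\<close> by (intro CollectI exI[of _ "\<lambda>s. a * c s"]) (auto simp: scaleR_sum_right)
    qed
  qed
qed

section \<open>Faces of finitely generated cones\<close>

lemma convex_cone_face_of:
  assumes "\<tau> face_of \<sigma>" "convex_cone \<sigma>" "\<tau> \<noteq> {}"
  shows "convex_cone \<tau>"
proof -
  have scale: "c *\<^sub>R p \<in> \<tau>" if "p \<in> \<tau>" "0 \<le> c" for p c
  proof (cases "p = 0")
    case False
    have p: "p \<in> \<sigma>" using that(1) face_of_imp_subset[OF assms(1)] by blast
    \<comment> \<open>The factor \<open>c + 2\<close> exceeds both 1 and \<open>c\<close>: the face
      property captures the two endpoints, and convexity then gives the multiple by
      \<open>c\<close>.\<close>
    have "p \<in> open_segment 0 ((c + 2) *\<^sub>R p)"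
      unfolding in_segment using False that(2) by (intro conjI exI[of _ "1 / (c + 2)"]) auto
    then have "0 \<in> \<tau>" "(c + 2) *\<^sub>R p \<in> \<tau>"
      using face_ofD[OF assms(1) _ convex_cone_contains_0[OF assms(2)]
        convex_cone_scaleR[OF assms(2) _ p] that(1)] that(2) by auto
    then have "(1 - c / (c + 2)) *\<^sub>R 0 + (c / (c + 2)) *\<^sub>R ((c + 2) *\<^sub>R p) \<in> \<tau>"
      using face_of_imp_convex[OF assms(1)] that(2) by (intro convexD_alt) auto
    then show ?thesis using that(2) by simp
  qed (use that in simp)
  then have "cone \<tau>" "0 \<in> \<tau>" using assms(3) unfolding cone_def by (auto, metis scale_zero_left order_refl)
  then show ?thesis using face_of_imp_convex[OF assms(1)] unfolding convex_cone_def conic_def cone_def by auto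
qed

text \<open>The sum is the midpoint of the doubles of \<open>a\<close> and \<open>b\<close>; when
  \<open>a = b\<close> there is no open segment, but the sum is itself the double.\<close>

lemma face_of_convex_cone_add:
  assumes "\<tau> face_of \<sigma>" "convex_cone \<sigma>" "a \<in> \<sigma>" "b \<in> \<sigma>" "a + b \<in> \<tau>"
  shows "a \<in> \<tau>"
proof -
  have "2 *\<^sub>R a \<in> \<tau>"
  proof (cases "a = b")
    case False
    then have "a + b \<in> open_segment (2 *\<^sub>R a) (2 *\<^sub>R b)"
      unfolding in_segment by (intro conjI exI[of _ "1/2"]) auto
    then show ?thesis
      using face_ofD[OF assms(1), of "a + b" "2 *\<^sub>R a" "2 *\<^sub>R b"] assms
        convex_cone_scaleR[OF assms(2), of 2] by simp
  qed (use assms(5) in \<open>simp add: scaleR_2\<close>)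
  moreover have "convex_cone \<tau>" using convex_cone_face_of assms(1,2,5) by blast
  ultimately show ?thesis using convex_cone_scaleR[of \<tau> "1/2" "2 *\<^sub>R a"] by simp
qed

lemma generator_in_face_of:
  assumes "\<tau> face_of convex_cone hull S" "finite S"
    and "\<And>s. s \<in> S \<Longrightarrow> 0 \<le> c s" "(\<Sum>s\<in>S. c s *\<^sub>R s) \<in> \<tau>" "s \<in> S" "0 < c s"
  shows "s \<in> \<tau>"
proof -
  let ?\<sigma> = "convex_cone hull S"
  have cc: "convex_cone ?\<sigma>" by (rule convex_cone_convex_cone_hull)
  have S: "S \<subseteq> ?\<sigma>" by (rule hull_subset)
  have "c s *\<^sub>R s + (\<Sum>s\<in>S - {s}. c s *\<^sub>R s) \<in> \<tau>"
    using assms(4) sum.remove[OF assms(2,5), of "\<lambda>s. c s *\<^sub>R s"] by simp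
  then have "c s *\<^sub>R s \<in> \<tau>"
  proof (rule face_of_convex_cone_add[OF assms(1) cc, rotated 2])
    show "c s *\<^sub>R s \<in> ?\<sigma>" using S assms(5,6) by (intro convex_cone_scaleR[OF cc]) auto
    show "(\<Sum>s\<in>S - {s}. c s *\<^sub>R s) \<in> ?\<sigma>" using S assms(3) by (intro convex_cone_sum[OF cc]) auto
  qed
  moreover have "convex_cone \<tau>" using convex_cone_face_of[OF assms(1) cc] assms(4) by blast
  ultimately show ?thesis using convex_cone_scaleR[of \<tau> "1 / c s" "c s *\<^sub>R s"] assms(6) by simp
qed

text \<open>Every generator with a positive coefficient at a point of the face lies in the face.
  This makes faces rational and finite in number.\<close>

lemma face_of_convex_cone_hull:
  assumes "\<tau> face_of convex_cone hull S" "finite S" "\<tau> \<noteq> {}"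
  shows "\<tau> = convex_cone hull (S \<inter> \<tau>)"
proof
  show "convex_cone hull (S \<inter> \<tau>) \<subseteq> \<tau>"
    using convex_cone_face_of[OF assms(1) convex_cone_convex_cone_hull assms(3)] by (intro hull_minimal) auto
  show "\<tau> \<subseteq> convex_cone hull (S \<inter> \<tau>)"
  proof
    fix x assume x: "x \<in> \<tau>"
    then have "x \<in> convex_cone hull S" using face_of_imp_subset[OF assms(1)] by blast
    then obtain c where c: "x = (\<Sum>s\<in>S. c s *\<^sub>R s)" "\<forall>s\<in>S. 0 \<le> c s"
      unfolding convex_cone_hull_explicit[OF assms(2)] by auto
    then have "s \<in> \<tau>" if "s \<in> S" "0 < c s" for s
      using generator_in_face_of[OF assms(1,2), of c s] that x by auto
    then show "x \<in> convex_cone hull (S \<inter> \<tau>)"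
      unfolding c(1) using c(2) by (intro convex_cone_sum convex_cone_convex_cone_hull) (auto intro: hull_inc)
  qed
qed

lemma rational_cone_face_of:
  assumes "rational_cone N \<sigma>" "\<tau> face_of \<sigma>" "\<tau> \<noteq> {}" shows "rational_cone N \<tau>"
proof -
  obtain S where S: "finite S" "S \<subseteq> N" "\<sigma> = convex_cone hull S"
    using assms(1) unfolding rational_cone_def by blast
  then have "\<tau> = convex_cone hull (S \<inter> \<tau>)" using face_of_convex_cone_hull assms(2,3) by blast
  then show ?thesis using S unfolding rational_cone_def by blast
qed

lemma finite_faces_rational_cone:
  assumes "rational_cone N \<sigma>" shows "finite {\<tau>. \<tau> face_of \<sigma>}"
proof -
  obtain S where S: "finite S" "\<sigma> = convex_cone hull S"
    using assms unfolding rational_cone_def by blast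
  have "\<tau> \<in> insert {} ((\<lambda>T. convex_cone hull T) ` Pow S)" if "\<tau> face_of \<sigma>" for \<tau>
    using face_of_convex_cone_hull[of \<tau> S] that S by blast
  then have "{\<tau>. \<tau> face_of \<sigma>} \<subseteq> insert {} ((\<lambda>T. convex_cone hull T) ` Pow S)" by blast
  then show ?thesis by (rule finite_subset) (simp add: S(1))
qed

text \<open>Intersections of smaller faces reduce to those of the given cones:
  \<open>\<tau> \<inter> (C \<inter> D)\<close> is a face of \<open>C\<close>, and its intersection
  with \<open>\<sigma>\<close> is \<open>\<sigma> \<inter> \<tau>\<close>.\<close>

lemma fan_of_faces:
  assumes "finite \<C>" "\<And>C. C \<in> \<C> \<Longrightarrow> rational_cone N C"
    and int: "\<And>C D. C \<in> \<C> \<Longrightarrow> D \<in> \<C> \<Longrightarrow> C \<inter> D face_of C"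
  shows "fan N {\<tau>. \<tau> \<noteq> {} \<and> (\<exists>C\<in>\<C>. \<tau> face_of C)}"
  unfolding fan_def
proof (intro conjI ballI allI impI)
  have "{\<tau>. \<tau> \<noteq> {} \<and> (\<exists>C\<in>\<C>. \<tau> face_of C)} \<subseteq> (\<Union>C\<in>\<C>. {\<tau>. \<tau> face_of C})" by blast
  then show "finite {\<tau>. \<tau> \<noteq> {} \<and> (\<exists>C\<in>\<C>. \<tau> face_of C)}"
    by (rule finite_subset) (use assms(1,2) finite_faces_rational_cone in blast)
next
  fix \<sigma> assume "\<sigma> \<in> {\<tau>. \<tau> \<noteq> {} \<and> (\<exists>C\<in>\<C>. \<tau> face_of C)}"
  then show "rational_cone N \<sigma>" using assms(2) rational_cone_face_of by blast
next
  fix \<sigma> \<tau> assume "\<sigma> \<in> {\<tau>. \<tau> \<noteq> {} \<and> (\<exists>C\<in>\<C>. \<tau> face_of C)}" "\<tau> face_of \<sigma> \<and> \<tau> \<noteq> {}"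
  then show "\<tau> \<in> {\<tau>. \<tau> \<noteq> {} \<and> (\<exists>C\<in>\<C>. \<tau> face_of C)}" using face_of_trans by blast
next
  have *: "\<sigma> \<inter> \<tau> face_of \<sigma>" if "C \<in> \<C>" "D \<in> \<C>" "\<sigma> face_of C" "\<tau> face_of D" for \<sigma> \<tau> C D
  proof -
    have "C \<inter> D face_of D" "C \<inter> D face_of C"
      using int[OF that(2,1)] int[OF that(1,2)] by (simp_all add: Int_commute)
    then have "\<tau> \<inter> (C \<inter> D) face_of D" using face_of_Int[OF that(4)] by blast
    then have "\<tau> \<inter> (C \<inter> D) face_of C \<inter> D" by (rule face_of_subset) auto
    then have "\<tau> \<inter> (C \<inter> D) face_of C" using \<open>C \<inter> D face_of C\<close> face_of_trans by blast
    then have "\<sigma> \<inter> (\<tau> \<inter> (C \<inter> D)) face_of C" by (rule face_of_Int[OF that(3)])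
    moreover have "\<sigma> \<inter> (\<tau> \<inter> (C \<inter> D)) = \<sigma> \<inter> \<tau>"
      using face_of_imp_subset[OF that(3)] face_of_imp_subset[OF that(4)] by blast
    ultimately show ?thesis using face_of_subset[OF _ _ face_of_imp_subset[OF that(3)]] by auto
  qed
  fix \<sigma> \<tau>
  assume "\<sigma> \<in> {\<tau>. \<tau> \<noteq> {} \<and> (\<exists>C\<in>\<C>. \<tau> face_of C)}" "\<tau> \<in> {\<tau>. \<tau> \<noteq> {} \<and> (\<exists>C\<in>\<C>. \<tau> face_of C)}"
  then obtain C D where "C \<in> \<C>" "D \<in> \<C>" "\<sigma> face_of C" "\<tau> face_of D" by blast
  then show "\<sigma> \<inter> \<tau> face_of \<sigma>" "\<sigma> \<inter> \<tau> face_of \<tau>"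
    using *[of C D \<sigma> \<tau>] *[of D C \<tau> \<sigma>] by (simp_all add: Int_commute)
qed

section \<open>Closedness of cones along lines\<close>

lemma conic_caratheodory:
  assumes "finite S" "x \<in> convex_cone hull S"
  obtains T where "T \<subseteq> S" "independent T" "x \<in> convex_cone hull T"
proof -
  define P where "P T \<longleftrightarrow> T \<subseteq> S \<and> x \<in> convex_cone hull T" for T
  have "P S" using assms unfolding P_def by blast
  then obtain T where T: "P T" and min: "\<And>T'. P T' \<Longrightarrow> card T \<le> card T'"
    using ex_has_least_nat[of P S card] by blast
  have fin: "finite T" using T assms(1) finite_subset unfolding P_def by blast
  have "independent T"
  proof
    assume "dependent T"
    then obtain d where d: "(\<Sum>v\<in>T. d v *\<^sub>R v) = 0" "\<exists>v\<in>T. 0 < d v"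
    proof -
      obtain d v where d: "(\<Sum>v\<in>T. d v *\<^sub>R v) = 0" "v \<in> T" "d v \<noteq> 0"
        using \<open>dependent T\<close> fin dependent_finite by blast
      show thesis
      proof (cases "0 < d v")
        case True
        then show thesis using that d by blast
      next
        case False
        have "(\<Sum>v\<in>T. (- d v) *\<^sub>R v) = 0" using d(1) by (simp add: sum_negf)
        then show thesis using that[of "\<lambda>v. - d v"] d False by force
      qed
    qed
    obtain c where c: "x = (\<Sum>s\<in>T. c s *\<^sub>R s)" "\<forall>s\<in>T. 0 \<le> c s"
      using T convex_cone_hull_explicit[OF fin] unfolding P_def by auto
    \<comment> \<open>The least ratio is the largest multiple of the relation \<open>d\<close> that
      can be subtracted with all coefficients staying nonnegative; it removes
      \<open>q\<close>.\<close>
    define q where "q = arg_min_on (\<lambda>v. c v / d v) {v \<in> T. 0 < d v}"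
    have ne: "{v \<in> T. 0 < d v} \<noteq> {}" "finite {v \<in> T. 0 < d v}" using d(2) fin by auto
    have q: "q \<in> T" "0 < d q" unfolding q_def using arg_min_if_finite(1)[OF ne(2,1)] by auto
    have qmin: "c q / d q \<le> c v / d v" if "v \<in> T" "0 < d v" for v
      unfolding q_def using arg_min_least[OF ne(2,1), of v] that by auto
    define e where "e v = c v - c q / d q * d v" for v
    have "0 \<le> c q / d q" using c(2) q by simp
    have "0 \<le> e v" if v: "v \<in> T" for v
    proof (cases "0 < d v")
      case True
      then show ?thesis using qmin[OF v] unfolding e_def by (simp add: pos_le_divide_eq)
    next
      case False
      then have "c q / d q * d v \<le> 0" using \<open>0 \<le> c q / d q\<close> by (intro mult_nonneg_nonpos) auto
      moreover have "0 \<le> c v" using c(2) v by blast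
      ultimately show ?thesis unfolding e_def by linarith
    qed
    moreover have "x = (\<Sum>s\<in>T. e s *\<^sub>R s)"
    proof -
      have "(\<Sum>s\<in>T. e s *\<^sub>R s) = x - (c q / d q) *\<^sub>R (\<Sum>v\<in>T. d v *\<^sub>R v)"
        unfolding e_def c(1) by (simp add: scaleR_left.diff sum_subtractf scaleR_sum_right)
      then show ?thesis using d(1) by simp
    qed
    moreover have "e q = 0" using q unfolding e_def by simp
    ultimately have "x = (\<Sum>s\<in>T - {q}. e s *\<^sub>R s)" "\<forall>s\<in>T - {q}. 0 \<le> e s"
      using sum.remove[OF fin q(1), of "\<lambda>s. e s *\<^sub>R s"] by auto
    then have "P (T - {q})" using T fin unfolding P_def by (auto simp: convex_cone_hull_explicit)
    then show False using min[of "T - {q}"] card_Diff1_less[OF fin q(1)] by simp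
  qed
  then show thesis using that T unfolding P_def by blast
qed

text \<open>The space has no topology, so closedness is stated along lines. The cone is a finite
  union of cones over independent sets, each given by linear inequalities.\<close>

lemma closed_line_convex_cone_hull:
  assumes "finite S"
  shows "closed {t :: real. x + t *\<^sub>R y \<in> convex_cone hull S}"
proof -
  have ind: "closed {t :: real. x + t *\<^sub>R y \<in> convex_cone hull T}" if T: "independent T" for T
  proof -
    let ?R = "representation (extend_basis T)"
    have ext: "independent (extend_basis T)" "T \<subseteq> extend_basis T" "span (extend_basis T) = UNIV"
      using independent_extend_basis[OF T] extend_basis_superset[OF T] span_extend_basis[OF T] by auto
    \<comment> \<open>Coordinates refer to a basis extending \<open>T\<close>; vanishing outside
      \<open>T\<close> is written as two inequalities.\<close>
    have hull: "convex_cone hull T = {v. \<forall>b. 0 \<le> ?R v b \<and> (b \<notin> T \<longrightarrow> ?R v b \<le> 0)}"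
    proof
      show "convex_cone hull T \<subseteq> {v. \<forall>b. 0 \<le> ?R v b \<and> (b \<notin> T \<longrightarrow> ?R v b \<le> 0)}"
      proof (rule hull_minimal)
        show "T \<subseteq> {v. \<forall>b. 0 \<le> ?R v b \<and> (b \<notin> T \<longrightarrow> ?R v b \<le> 0)}"
          using representation_basis[OF ext(1)] ext(2) by auto
        show "convex_cone {v. \<forall>b. 0 \<le> ?R v b \<and> (b \<notin> T \<longrightarrow> ?R v b \<le> 0)}"
          unfolding convex_cone_iff
          by (auto simp: representation_zero representation_add[OF ext(1)] representation_scale[OF ext(1)] ext(3)
              intro: add_nonpos_nonpos mult_nonneg_nonpos)
      qed
      show "{v. \<forall>b. 0 \<le> ?R v b \<and> (b \<notin> T \<longrightarrow> ?R v b \<le> 0)} \<subseteq> convex_cone hull T"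
      proof safe
        fix v assume v: "\<forall>b. 0 \<le> ?R v b \<and> (b \<notin> T \<longrightarrow> ?R v b \<le> 0)"
        have "(\<Sum>b | ?R v b \<noteq> 0. ?R v b *\<^sub>R b) \<in> convex_cone hull T"
          using v by (intro convex_cone_sum convex_cone_convex_cone_hull) (auto intro: hull_inc simp: not_le[symmetric])
        then show "v \<in> convex_cone hull T"
          using sum_nonzero_representation_eq[OF ext(1), of v] ext(3) by simp
      qed
    qed
    have "{t :: real. x + t *\<^sub>R y \<in> convex_cone hull T} =
      (\<Inter>b. {t. 0 \<le> ?R x b + t * ?R y b}) \<inter> (\<Inter>b\<in>- T. {t. ?R x b + t * ?R y b \<le> 0})"
      unfolding hull by (auto simp: representation_add[OF ext(1)] representation_scale[OF ext(1)] ext(3))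
    also have "closed \<dots>"
      by (intro closed_Int closed_INT ballI closed_Collect_le continuous_intros)
    finally show ?thesis .
  qed
  have "{t :: real. x + t *\<^sub>R y \<in> convex_cone hull S} =
    (\<Union>T\<in>{T. T \<subseteq> S \<and> independent T}. {t. x + t *\<^sub>R y \<in> convex_cone hull T})"
  proof (intro equalityI subsetI)
    fix t assume "t \<in> {t :: real. x + t *\<^sub>R y \<in> convex_cone hull S}"
    then obtain T where "T \<subseteq> S" "independent T" "x + t *\<^sub>R y \<in> convex_cone hull T"
      using conic_caratheodory[OF assms] by (metis mem_Collect_eq)
    then show "t \<in> (\<Union>T\<in>{T. T \<subseteq> S \<and> independent T}. {t. x + t *\<^sub>R y \<in> convex_cone hull T})" by blast
  next
    fix t assume "t \<in> (\<Union>T\<in>{T. T \<subseteq> S \<and> independent T}. {t. x + t *\<^sub>R y \<in> convex_cone hull T})"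
    then obtain T where T: "T \<subseteq> S" "x + t *\<^sub>R y \<in> convex_cone hull T" by blast
    show "t \<in> {t :: real. x + t *\<^sub>R y \<in> convex_cone hull S}" using hull_mono[OF T(1)] T(2) by blast
  qed
  also have "closed \<dots>" using ind assms by (intro closed_UN) auto
  finally show ?thesis .
qed

text \<open>The pieces on which \<open>g\<close> takes the value \<open>g 0\<close>, and the
  remaining pieces, would form two disjoint nonempty closed sets covering a connected
  interval.\<close>

lemma constant_on_interval_of_closed_cover:
  fixes g :: "real \<Rightarrow> 'b" and A :: "'i \<Rightarrow> real set"
  assumes "finite I" "\<And>i. i \<in> I \<Longrightarrow> closed (A i)" "{0..1} \<subseteq> (\<Union>i\<in>I. A i)"
    and const: "\<And>i s t. i \<in> I \<Longrightarrow> s \<in> A i \<inter> {0..1} \<Longrightarrow> t \<in> A i \<inter> {0..1} \<Longrightarrow> g s = g t"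
  shows "g 0 = g 1"
proof (rule ccontr)
  assume ne: "g 0 \<noteq> g 1"
  define J where "J = {i \<in> I. \<exists>t\<in>A i \<inter> {0..1}. g t = g 0}"
  let ?K = "(\<Union>i\<in>J. A i) \<inter> {0..1}" and ?L = "(\<Union>i\<in>I - J. A i) \<inter> {0..1}"
  have cl: "closed ?K" "closed ?L"
    using assms(1,2) unfolding J_def by (auto intro!: closed_Int closed_UN)
  have K: "g t = g 0" if t: "t \<in> ?K" for t
  proof -
    obtain i where i: "i \<in> J" "t \<in> A i \<inter> {0..1}" using t by blast
    then obtain s where "s \<in> A i \<inter> {0..1}" "g s = g 0" "i \<in> I" unfolding J_def by blast
    then show ?thesis using const[of i t s] i(2) by simp
  qed
  have L: "g t \<noteq> g 0" if t: "t \<in> ?L" for t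
  proof
    obtain i where i: "i \<in> I" "i \<notin> J" "t \<in> A i \<inter> {0..1}" using t by blast
    assume "g t = g 0"
    then have "\<exists>t\<in>A i \<inter> {0..1}. g t = g 0" using i(3) by blast
    then show False using i(1,2) unfolding J_def by blast
  qed
  have cov: "{0..1} \<subseteq> ?K \<union> ?L" using assms(3) by blast
  have "0 \<in> ?K \<union> ?L" by (rule subsetD[OF cov]) simp
  then have 0: "?K \<inter> {0..1} \<noteq> {}" using L[of 0] by blast
  have "1 \<in> ?K \<union> ?L" by (rule subsetD[OF cov]) simp
  then have 1: "?L \<inter> {0..1} \<noteq> {}" using K[of 1] ne by fastforce
  have disj: "?K \<inter> ?L \<inter> {0..1} = {}"
  proof (rule equals0I)
    fix t assume "t \<in> ?K \<inter> ?L \<inter> {0..1}"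
    then have "g t = g 0" "g t \<noteq> g 0" using K[of t] L[of t] by blast+
    then show False by simp
  qed
  have "connected {0..1::real}" by simp
  then show False using connected_closedD[OF _ disj cov cl] 0 1 by blast
qed

section \<open>The fan of regions in \<open>\<real>\<^sup>r/\<real>1\<close>\<close>

text \<open>Induction on the number of values: lowering the largest value \<open>M\<close> to the
  next one subtracts a positive multiple of the indicator of the top superlevel set.\<close>

lemma in_superlevel_cone:
  fixes y :: "real^'r::finite"
  shows "\<exists>c. y + c *\<^sub>R 1 \<in> convex_cone hull (ind_vec ` range (\<lambda>t. {i. t \<le> y $ i}))"
proof (induction "card (range (($) y))" arbitrary: y rule: less_induct)
  case less
  define M where "M = Max (range (($) y))"
  have M: "y $ i \<le> M" for i unfolding M_def by (rule Max_ge) auto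
  have Min: "M \<in> range (($) y)" unfolding M_def by (rule Max_in) auto
  show ?case
  proof (cases "range (($) y) = {M}")
    case True
    then have "y $ i = M" for i by blast
    then have "y + (- M) *\<^sub>R 1 = 0" by (simp add: vec_eq_iff)
    then show ?thesis using convex_cone_hull_contains_0 by metis
  next
    case False
    define M' where "M' = Max (range (($) y) - {M})"
    have ne: "range (($) y) - {M} \<noteq> {}" using False Min by blast
    have M'in: "M' \<in> range (($) y) - {M}" unfolding M'_def by (rule Max_in) (use ne in auto)
    have M': "y $ i \<le> M'" if "y $ i \<noteq> M" for i
      unfolding M'_def using that by (intro Max_ge) simp_all
    obtain i where i: "y $ i = M'" "M' \<noteq> M" using M'in by auto
    have "M' < M" using M[of i] i by simp
    define y' where "y' = y - (M - M') *\<^sub>R ind_vec {i. M \<le> y $ i}"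
    have y': "y' $ i = min (y $ i) M'" for i
      using M[of i] M'[of i] \<open>M' < M\<close> unfolding y'_def by (auto simp: ind_vec_nth min_def)
    have sub: "range (\<lambda>t. {i. t \<le> y' $ i}) \<subseteq> range (\<lambda>t. {i. t \<le> y $ i})"
    proof safe
      fix t
      show "{i. t \<le> y' $ i} \<in> range (\<lambda>t. {i. t \<le> y $ i})"
      proof (cases "t \<le> M'")
        case False
        \<comment> \<open>Both sets are empty, since \<open>M + 1\<close> is above every coordinate
          of \<open>y\<close>.\<close>
        then have "{i. t \<le> y' $ i} = {i. M + 1 \<le> y $ i}" using M by (auto simp: y' not_le intro: le_less_trans[of _ M])
        then show ?thesis by blast
      qed (auto simp: y')
    qed
    have "range (($) y') \<subseteq> range (($) y) - {M}"
      using M'in \<open>M' < M\<close> by (auto simp: y' min_def)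
    then have "card (range (($) y')) \<le> card (range (($) y) - {M})" by (intro card_mono) auto
    also have "\<dots> < card (range (($) y))" using Min by (intro card_Diff1_less) auto
    finally obtain c where c: "y' + c *\<^sub>R 1 \<in> convex_cone hull (ind_vec ` range (\<lambda>t. {i. t \<le> y' $ i}))"
      using less by blast
    have "y + c *\<^sub>R 1 = (y' + c *\<^sub>R 1) + (M - M') *\<^sub>R ind_vec {i. M \<le> y $ i}" unfolding y'_def by simp
    also have "\<dots> \<in> convex_cone hull (ind_vec ` range (\<lambda>t. {i. t \<le> y $ i}))"
    proof (rule convex_cone_hull_add)
      show "y' + c *\<^sub>R 1 \<in> convex_cone hull (ind_vec ` range (\<lambda>t. {i. t \<le> y $ i}))"
        using c hull_mono[OF image_mono[OF sub], of convex_cone ind_vec] by blast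
      show "(M - M') *\<^sub>R ind_vec {i. M \<le> y $ i} \<in> convex_cone hull (ind_vec ` range (\<lambda>t. {i. t \<le> y $ i}))"
        using \<open>M' < M\<close> by (intro convex_cone_hull_mul hull_inc) auto
    qed
    finally show ?thesis by blast
  qed
qed

section \<open>The quotient by \<open>1\<close> and a linear section\<close>

lemma linear_mod_ones: "linear mod_ones"
  by (rule linearI) (simp_all add: plus_mod_ones.abs_eq scaleR_mod_ones.abs_eq)

lemma mod_ones_shift: "mod_ones (y + c *\<^sub>R 1) = mod_ones y"
  by (simp add: mod_ones.abs_eq_iff)

lemma mod_ones_cases: obtains y where "z = mod_ones y"
  by (induction z rule: mod_ones.abs_induct) blast

text \<open>Normalizing coordinate \<open>j\<close> to zero cancels the arbitrary choice in
  \<open>rep_mod_ones\<close>, which makes the section linear and integral.\<close>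

definition mod_ones_section :: "'r::finite \<Rightarrow> 'r mod_ones \<Rightarrow> real^'r" where
  "mod_ones_section j z = rep_mod_ones z - (rep_mod_ones z $ j) *\<^sub>R 1"

lemma mod_ones_section: "mod_ones_section j (mod_ones y) = y - (y $ j) *\<^sub>R 1"
proof -
  have "mod_ones (rep_mod_ones (mod_ones y)) = mod_ones y"
    by (rule Quotient3_abs_rep[OF Quotient3_mod_ones])
  then obtain c where "rep_mod_ones (mod_ones y) - y = c *\<^sub>R 1" by (auto simp: mod_ones.abs_eq_iff)
  then have "rep_mod_ones (mod_ones y) = y + c *\<^sub>R 1" by (simp add: algebra_simps)
  then show ?thesis unfolding mod_ones_section_def by (simp add: scaleR_left.add)
qed

lemma linear_mod_ones_section: "linear (mod_ones_section j)"
proof (rule linearI)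
  fix x y :: "'a mod_ones"
  obtain a b where "x = mod_ones a" "y = mod_ones b" by (metis mod_ones_cases)
  then show "mod_ones_section j (x + y) = mod_ones_section j x + mod_ones_section j y"
    by (simp add: plus_mod_ones.abs_eq mod_ones_section scaleR_left.add)
next
  fix c and x :: "'a mod_ones"
  obtain a where "x = mod_ones a" by (metis mod_ones_cases)
  then show "mod_ones_section j (c *\<^sub>R x) = c *\<^sub>R mod_ones_section j x"
    by (simp add: scaleR_mod_ones.abs_eq mod_ones_section scaleR_right_diff_distrib)
qed

lemma mod_ones_section_lattice: "mod_ones_section j ` mod_ones_lattice \<subseteq> int_vectors"
  unfolding mod_ones_lattice_def int_vectors_def by (auto simp: mod_ones_section)

section \<open>The fan of regions and its piecewise linear map\<close>

context flat_map
begin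

lemma mod_ones_in_region_iff: "mod_ones y \<in> mod_ones ` region w \<longleftrightarrow> y \<in> region w"
proof
  assume "mod_ones y \<in> mod_ones ` region w"
  then obtain y' c where "y' \<in> region w" "y - y' = c *\<^sub>R 1" by (auto simp: mod_ones.abs_eq_iff)
  then show "y \<in> region w" using region_shift_iff[of y' c w] by (simp add: algebra_simps)
qed blast

lemma convex_cone_mod_region: "inj (($) w) \<Longrightarrow> convex_cone (mod_ones ` region w)"
  by (intro convex_cone_linear_image conjI convex_cone_region linear_mod_ones)

lemma rational_cone_region:
  assumes w: "inj (($) w)" shows "rational_cone mod_ones_lattice (mod_ones ` region w)"
proof -
  have "mod_ones ` region w = convex_cone hull (mod_ones ` ind_vec ` upsets w)"
  proof
    show "convex_cone hull (mod_ones ` ind_vec ` upsets w) \<subseteq> mod_ones ` region w"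
      using convex_cone_mod_region[OF w] by (intro hull_minimal) (auto intro: ind_vec_in_region)
    show "mod_ones ` region w \<subseteq> convex_cone hull (mod_ones ` ind_vec ` upsets w)"
    proof safe
      fix y assume "y \<in> region w"
      then have "range (\<lambda>t. {i. t \<le> y $ i}) \<subseteq> upsets w" unfolding region_def by blast
      then have "convex_cone hull (ind_vec ` range (\<lambda>t. {i. t \<le> y $ i})) \<subseteq> convex_cone hull (ind_vec ` upsets w)"
        by (intro hull_mono image_mono)
      then obtain c where "y + c *\<^sub>R 1 \<in> convex_cone hull (ind_vec ` upsets w)"
        using in_superlevel_cone[of y] by blast
      then have "mod_ones (y + c *\<^sub>R 1) \<in> convex_cone hull (mod_ones ` ind_vec ` upsets w)"
        unfolding convex_cone_hull_linear_image[OF linear_mod_ones] by blast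
      then show "mod_ones y \<in> convex_cone hull (mod_ones ` ind_vec ` upsets w)"
        by (simp only: mod_ones_shift)
    qed
  qed
  moreover have "mod_ones ` ind_vec ` upsets w \<subseteq> mod_ones_lattice"
    unfolding mod_ones_lattice_def int_vectors_def by (auto simp: ind_vec_nth)
  ultimately show ?thesis unfolding rational_cone_def by (metis finite finite_imageI)
qed

lemma region_Int_face_of:
  assumes w: "inj (($) w)" and w': "inj (($) w')"
  shows "mod_ones ` region w \<inter> mod_ones ` region w' face_of mod_ones ` region w"
  unfolding face_of_def
proof (intro conjI ballI impI)
  show "convex (mod_ones ` region w \<inter> mod_ones ` region w')"
    using convex_cone_mod_region[OF w] convex_cone_mod_region[OF w'] unfolding convex_cone_def by (intro convex_Int) auto
next
  fix a b x
  assume "a \<in> mod_ones ` region w" "b \<in> mod_ones ` region w"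
    and x: "x \<in> mod_ones ` region w \<inter> mod_ones ` region w'" "x \<in> open_segment a b"
  then obtain p q s where p: "a = mod_ones p" "p \<in> region w" and q: "b = mod_ones q" "q \<in> region w"
    and s: "0 < s" "s < 1" "x = (1 - s) *\<^sub>R a + s *\<^sub>R b"
    unfolding in_segment by auto
  let ?m = "(1 - s) *\<^sub>R p + s *\<^sub>R q"
  have "x = mod_ones ?m" unfolding s(3) p(1) q(1) by (simp add: plus_mod_ones.abs_eq scaleR_mod_ones.abs_eq)
  then have "?m \<in> region w'" using x(1) mod_ones_in_region_iff by auto
  then have "p \<in> region w' \<and> q \<in> region w'" by (rule region_face[OF w w' p(2) q(2) refl s(1,2)])
  then show "a \<in> mod_ones ` region w \<inter> mod_ones ` region w'" "b \<in> mod_ones ` region w \<inter> mod_ones ` region w'"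
    using p q by auto
qed simp

definition region_fan :: "'r mod_ones set set" where
  "region_fan = {\<tau>. \<tau> \<noteq> {} \<and> (\<exists>C\<in>{mod_ones ` region w | w. inj (($) w)}. \<tau> face_of C)}"

lemma region_in_fan:
  assumes w: "inj (($) w)" shows "mod_ones ` region w \<in> region_fan"
proof -
  have "mod_ones ` region w face_of mod_ones ` region w"
    using convex_cone_mod_region[OF w] unfolding convex_cone_def by (intro face_of_refl) auto
  then show ?thesis unfolding region_fan_def using w zero_in_region by blast
qed

lemma complete_fan_region_fan: "complete_fan mod_ones_lattice region_fan"
  unfolding complete_fan_def
proof
  \<comment> \<open>A region depends on \<open>w\<close> only through the family
    \<open>upsets w\<close> of subsets of a finite set.\<close>
  have "{mod_ones ` region w | w. inj (($) w)} \<subseteq>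
    range (\<lambda>L. mod_ones ` {y. \<forall>t. {i. t \<le> y $ i} \<in> L})"
    unfolding region_def by blast
  then have "finite {mod_ones ` region w | w. inj (($) w)}" by (rule finite_subset) simp
  then show "fan mod_ones_lattice region_fan"
    unfolding region_fan_def by (rule fan_of_faces) (auto intro: rational_cone_region region_Int_face_of)
  have "z \<in> \<Union>region_fan" for z
  proof -
    obtain y where z: "z = mod_ones y" by (rule mod_ones_cases)
    obtain g :: "real^'r" where "inj (($) g)" by (rule ex_injective_vector)
    then obtain w :: "real^'r" where w: "inj (($) w)"
      "\<And>i j. w $ i \<le> w $ j \<longleftrightarrow> y $ i < y $ j \<or> y $ i = y $ j \<and> g $ i \<le> g $ j"
      using exists_injective_refinement by metis
    then have "y \<in> region w" by (intro region_refined) auto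
    then show ?thesis using region_in_fan[OF w(1)] z by blast
  qed
  then show "\<Union>region_fan = UNIV" by blast
qed

lemma coarsens_region_fan: "coarsens region_fan permutohedral_fan"
  unfolding coarsens_def permutohedral_fan_def
proof safe
  fix x :: "real^'r"
  obtain g :: "real^'r" where "inj (($) g)" by (rule ex_injective_vector)
  then obtain w :: "real^'r" where w: "inj (($) w)"
    "\<And>i j. w $ i \<le> w $ j \<longleftrightarrow> x $ i < x $ j \<or> x $ i = x $ j \<and> g $ i \<le> g $ j"
    using exists_injective_refinement by metis
  then have "x $ i \<le> x $ j" if "w $ i \<le> w $ j" for i j using that by auto
  then have "{y. \<forall>i j. x $ i \<le> x $ j \<longrightarrow> y $ i \<le> y $ j} \<subseteq> region w" by (auto intro: region_refined)
  then show "\<exists>\<xi>\<in>region_fan. mod_ones ` {y. \<forall>i j. x $ i \<le> x $ j \<longrightarrow> y $ i \<le> y $ j} \<subseteq> \<xi>"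
    by (intro bexI[OF _ region_in_fan[OF w(1)]] image_mono)
qed

text \<open>This formula mentions no basis, so different charts agree automatically. The maximum is
  over a nonempty set because \<open>F UNIV = UNIV\<close>.\<close>

definition flat_vector :: "real^'r \<Rightarrow> real^'e" where
  "flat_vector y = (\<chi> e. Max {y $ k | k. e \<in> F {i. y $ k \<le> y $ i}})"

text \<open>For an adapted basis, \<open>e\<close> lies in the flat at level \<open>y $ k\<close>
  iff \<open>y $ k\<close> is at most the apartment coordinate, and that coordinate is itself an
  entry of \<open>y\<close>.\<close>

lemma flat_vector_apartment:
  assumes l: "loopless indep" and b: "ordered_basis indep b" and y: "y \<in> apartment_region b"
  shows "flat_vector y = apartment_map indep b y"
  unfolding vec_eq_iff
proof
  fix e
  let ?a = "apartment_map indep b y $ e"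
  have iff: "e \<in> F {i. y $ k \<le> y $ i} \<longleftrightarrow> y $ k \<le> ?a" for k
    using F_eq_mcl[OF b] y apartment_map_ge_iff[OF l b] unfolding apartment_region_def by auto
  have "?a \<in> range (($) y)"
  proof (cases "e \<in> range b")
    case False
    let ?C = "fund_circuit indep (range b) e"
    have "mbasis indep (range b)" using b unfolding ordered_basis_def by simp
    then have "?C - {e} \<noteq> {}" using fund_circuit_nonempty[OF matroid l] False by blast
    then have "?a \<in> (\<lambda>j. y $ inv b j) ` (?C - {e})"
      using Min_in[of "(\<lambda>j. y $ inv b j) ` (?C - {e})"] False by (simp add: apartment_map_def)
    then show ?thesis by blast
  qed (simp add: apartment_map_def)
  then have "Max {y $ k | k. y $ k \<le> ?a} = ?a" by (intro Max_eqI) auto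
  then show "flat_vector y $ e = ?a" unfolding flat_vector_def by (simp add: iff)
qed

lemma region_fan_chart:
  assumes l: "loopless indep" and "\<tau> \<in> region_fan"
  shows "\<exists>b. bundle_chart mod_ones_lattice indep (\<lambda>z. flat_vector (mod_ones_section j z)) \<tau> b (mod_ones_section j)"
proof -
  obtain w where w: "inj (($) w)" and "\<tau> face_of mod_ones ` region w"
    using assms(2) unfolding region_fan_def by blast
  then have sub: "\<tau> \<subseteq> mod_ones ` region w" using face_of_imp_subset by blast
  obtain b where b: "ordered_basis indep b" "region w \<subseteq> apartment_region b"
    using ex_region_apartment[OF w] .
  have "flat_vector (mod_ones_section j z) = apartment_map indep b (mod_ones_section j z)" if "z \<in> \<tau>" for z
  proof -
    have "z \<in> mod_ones ` region w" using that sub by blast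
    then obtain y where y: "z = mod_ones y" "y \<in> region w" by (rule imageE)
    have "mod_ones_section j z \<in> region w"
      using region_shift_iff[of y "- (y $ j)" w] y by (simp add: mod_ones_section)
    then show ?thesis using flat_vector_apartment[OF l b(1)] b(2) by blast
  qed
  then show ?thesis
    unfolding bundle_chart_def using b(1) linear_mod_ones_section mod_ones_section_lattice by blast
qed

end

section \<open>Bundles with global Chern roots\<close>

text \<open>A vector orthogonal to the range of \<open>f\<close> is a linear relation among the
  roots whose coefficients sum to zero.\<close>

lemma affinely_independent_surj:
  fixes u :: "'r::finite \<Rightarrow> 'a::real_vector \<Rightarrow> real"
  assumes lin: "\<And>i. linear (u i)" and aff: "affinely_independent u"
  obtains x c where "\<And>i. u i x = y $ i + c"
proof -
  define f where "f = (\<lambda>(x, c). (\<chi> i. u i x) + c *\<^sub>R (1 :: real^'r))"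
  have "linear f"
    by (rule linearI) (auto simp: f_def vec_eq_iff linear_add[OF lin] linear_scale[OF lin] algebra_simps)
  then have sub: "subspace (range f)" using linear_subspace_image subspace_UNIV by blast
  have "range f = UNIV"
  proof (rule ccontr)
    assume "range f \<noteq> UNIV"
    then have "span (range f) \<noteq> UNIV" using sub span_eq_iff by metis
    then obtain a where a: "a \<noteq> 0" "\<forall>v\<in>span (range f). a \<bullet> v = 0"
      using span_not_UNIV_orthogonal by blast
    have orth: "a \<bullet> f p = 0" for p using a(2) span_base[of "f p" "range f"] by blast
    have "(\<Sum>i\<in>UNIV. a $ i) = 0"
      using orth[of "(0, 1)"] by (simp add: f_def inner_vec_def linear_0[OF lin])
    moreover have "(\<Sum>i\<in>UNIV. a $ i * u i x) = 0" for x
      using orth[of "(x, 0)"] by (simp add: f_def inner_vec_def)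
    ultimately have "\<forall>i. a $ i = 0" using aff unfolding affinely_independent_def by blast
    then show False using a(1) by (simp add: vec_eq_iff)
  qed
  then obtain x c where "y = f (x, c)" by (metis surj_pair surjD)
  then have "u i x = y $ i + (- c)" for i by (simp add: f_def)
  then show thesis by (rule that)
qed

locale split_bundle = matroid_on indep for indep :: "'e::finite set \<Rightarrow> bool" +
  fixes N :: "'a::real_vector set" and \<Delta> :: "'a set set" and \<Phi> :: "'a \<Rightarrow> real^'e"
    and u :: "'r::finite \<Rightarrow> 'a \<Rightarrow> real"
  assumes loopless: "loopless indep" and complete: "complete_fan N \<Delta>"
    and roots: "global_chern_roots N indep \<Delta> \<Phi> u"
    and affine: "affinely_independent u"
begin

abbreviation "roots_at x \<equiv> (\<chi> i. u i x)"
abbreviation "chart \<delta> b \<equiv> bundle_chart N indep \<Phi> \<delta> b roots_at"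

lemma linear_root: "linear (u i)"
  using roots unfolding global_chern_roots_def dual_lattice_def by blast

lemma linear_roots_at: "linear roots_at"
  by (rule linearI) (auto simp: vec_eq_iff linear_add[OF linear_root] linear_scale[OF linear_root])

lemma roots_at_surj: obtains x c where "roots_at x = y + c *\<^sub>R 1"
proof -
  obtain x c where "\<And>i. u i x = y $ i + c"
    using affinely_independent_surj[of u y] linear_root affine by blast
  then have "roots_at x = y + c *\<^sub>R 1" by (simp add: vec_eq_iff)
  then show thesis by (rule that)
qed

lemma cover: obtains \<delta> b where "\<delta> \<in> \<Delta>" "x \<in> \<delta>" "chart \<delta> b"
  using complete roots unfolding complete_fan_def global_chern_roots_def by blast

lemma closed_line_cone: "\<delta> \<in> \<Delta> \<Longrightarrow> closed {t :: real. x + t *\<^sub>R y \<in> \<delta>}"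
  using complete closed_line_convex_cone_hull
  unfolding complete_fan_def fan_def rational_cone_def by metis

lemma chart_level_set:
  assumes "chart \<delta> b" "x \<in> \<delta>"
  shows "{e. t \<le> \<Phi> x $ e} = cl (b ` {i. t \<le> u i x})"
  using assms apartment_map_ge_iff[OF loopless, of b t "roots_at x"]
  unfolding bundle_chart_def by auto

text \<open>Along a segment between two points with the same dominant set \<open>A\<close> of roots, \<open>A\<close>
  stays dominant. So its span is a level set of \<open>\<Phi>\<close>, and it is constant on each of the
  finitely many closed pieces of the segment.\<close>

lemma chart_span_unique:
  assumes x: "\<delta> \<in> \<Delta>" "chart \<delta> b" "x \<in> \<delta>" and y: "\<delta>' \<in> \<Delta>" "chart \<delta>' b'" "y \<in> \<delta>'"
    and A: "A = {i. t \<le> u i x}" "A = {i. s \<le> u i y}"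
  shows "cl (b ` A) = cl (b' ` A)"
proof (cases "A = {}")
  case ne: False
  define m where "m z = Min ((\<lambda>i. u i z) ` A)" for z
  define p where "p r = x + r *\<^sub>R (y - x)" for r :: real
  define g where "g r = {e. m (p r) \<le> \<Phi> (p r) $ e}" for r
  have g: "g r = cl (c ` A)" if r: "r \<in> {0..1}" and c: "chart \<sigma> c" "p r \<in> \<sigma>" for r \<sigma> c
  proof -
    have up: "u i (p r) = (1 - r) * u i x + r * u i y" for i
      unfolding p_def
      by (simp add: linear_add[OF linear_root] linear_scale[OF linear_root] linear_diff[OF linear_root] algebra_simps)
    have "i \<in> A" if le: "m (p r) \<le> u i (p r)" for i
    proof (rule ccontr)
      assume i: "i \<notin> A"
      have "m (p r) \<in> (\<lambda>i. u i (p r)) ` A" unfolding m_def using ne by (intro Min_in) auto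
      then obtain j where j: "j \<in> A" "u j (p r) \<le> u i (p r)" using le by auto
      have "u i x < u j x" using i j(1) unfolding A(1) by simp
      moreover have "u i y < u j y" using i j(1) unfolding A(2) by simp
      ultimately have "u i (p r) < u j (p r)"
        using r convex_bound_lt unfolding up
        by (cases "r = 0") (auto intro!: add_le_less_mono mult_left_mono mult_strict_left_mono)
      then show False using j(2) by simp
    qed
    moreover have "m (p r) \<le> u i (p r)" if "i \<in> A" for i
      unfolding m_def using that by (intro Min_le) auto
    ultimately have "{i. m (p r) \<le> u i (p r)} = A" by blast
    then show ?thesis using chart_level_set[OF c] unfolding g_def by simp
  qed
  have "g 0 = g 1"
  proof (rule constant_on_interval_of_closed_cover[where I = \<Delta> and A = "\<lambda>\<sigma>. {r. p r \<in> \<sigma>}"])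
    show "finite \<Delta>" using complete unfolding complete_fan_def fan_def by blast
    show "closed {r. p r \<in> \<sigma>}" if "\<sigma> \<in> \<Delta>" for \<sigma> unfolding p_def using that by (rule closed_line_cone)
    show "{0..1} \<subseteq> (\<Union>\<sigma>\<in>\<Delta>. {r. p r \<in> \<sigma>})" using complete unfolding complete_fan_def by blast
  next
    fix \<sigma> r r' assume *: "\<sigma> \<in> \<Delta>" "r \<in> {r. p r \<in> \<sigma>} \<inter> {0..1}" "r' \<in> {r. p r \<in> \<sigma>} \<inter> {0..1}"
    then obtain c where c: "chart \<sigma> c" using roots unfolding global_chern_roots_def by blast
    show "g r = g r'" using g[of r, OF _ c] g[of r', OF _ c] * by simp
  qed
  moreover have "p 0 = x" "p 1 = y" unfolding p_def by simp_all
  ultimately show ?thesis using g[of 0, OF _ x(2)] g[of 1, OF _ y(2)] x(3) y(3) by simp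
qed simp

text \<open>The union runs over all charts and points with superlevel set \<open>A\<close>, which
  avoids a choice; they all contribute the same flat.\<close>

definition root_flat :: "'r set \<Rightarrow> 'e set" where
  "root_flat A = {e. \<exists>\<delta>\<in>\<Delta>. \<exists>x\<in>\<delta>. \<exists>b t. chart \<delta> b \<and> A = {i. t \<le> u i x} \<and> e \<in> cl (b ` A)}"

lemma root_flat_eq:
  assumes "\<delta> \<in> \<Delta>" "chart \<delta> b" "x \<in> \<delta>" "A = {i. t \<le> u i x}"
  shows "root_flat A = cl (b ` A)"
proof
  show "root_flat A \<subseteq> cl (b ` A)"
    unfolding root_flat_def using chart_span_unique[OF assms(1-3) _ _ _ assms(4)] by blast
  show "cl (b ` A) \<subseteq> root_flat A" unfolding root_flat_def using assms by blast
qed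

lemma ex_chart_superlevel:
  obtains \<delta> b x c where "\<delta> \<in> \<Delta>" "chart \<delta> b" "x \<in> \<delta>" "\<And>t. {i. t + c \<le> u i x} = {i. t \<le> y $ i}"
proof -
  obtain x c where x: "roots_at x = y + c *\<^sub>R 1" by (rule roots_at_surj)
  obtain \<delta> b where "\<delta> \<in> \<Delta>" "x \<in> \<delta>" "chart \<delta> b" by (rule cover)
  moreover have "u i x = y $ i + c" for i using x by (simp add: vec_eq_iff)
  ultimately show thesis by (intro that[of \<delta> b x c]) auto
qed

sublocale flat_map indep root_flat
proof
  have "mflat indep (root_flat A) \<and> rk (root_flat A) = card A" for A
  proof -
    obtain \<delta> b x c where *: "\<delta> \<in> \<Delta>" "chart \<delta> b" "x \<in> \<delta>" and lev: "\<And>t. {i. t + c \<le> u i x} = {i. t \<le> ind_vec A $ i}"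
      using ex_chart_superlevel[of "ind_vec A"] by blast
    have "{i. 1 + c \<le> u i x} = A" unfolding lev by (auto simp: ind_vec_nth)
    then have "root_flat A = cl (b ` A)" using root_flat_eq[OF *] by blast
    then show ?thesis using mflat_mcl rk_mcl rk_basis_image * unfolding bundle_chart_def by metis
  qed
  then show "mflat indep (root_flat A)" "rk (root_flat A) = card A" for A by auto
  show "root_flat A \<subseteq> root_flat B" if "A \<subseteq> B" for A B
  proof -
    \<comment> \<open>The sum of the indicators is 2 on \<open>A\<close> and 1 on the rest of
      \<open>B\<close>. Both sets are thus superlevel sets at one point, and one basis spans both
      flats.\<close>
    obtain \<delta> b x c where *: "\<delta> \<in> \<Delta>" "chart \<delta> b" "x \<in> \<delta>"
      and lev: "\<And>t. {i. t + c \<le> u i x} = {i. t \<le> (ind_vec A + ind_vec B) $ i}"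
      using ex_chart_superlevel[of "ind_vec A + ind_vec B"] by blast
    have "{i. 2 + c \<le> u i x} = A" "{i. 1 + c \<le> u i x} = B"
      unfolding lev using that by (auto simp: ind_vec_nth)
    then have "root_flat A = cl (b ` A)" "root_flat B = cl (b ` B)" using root_flat_eq[OF *] by blast+
    then show ?thesis using mcl_mono[of "b ` A" "b ` B"] that by blast
  qed
  show "root_flat UNIV = UNIV"
  proof -
    obtain \<delta> b where *: "\<delta> \<in> \<Delta>" "0 \<in> \<delta>" "chart \<delta> b" by (rule cover)
    have "UNIV = {i. 0 \<le> u i 0}" by (simp add: linear_0[OF linear_root])
    then have "root_flat UNIV = cl (range b)" using root_flat_eq * by blast
    then show ?thesis using mcl_basis * unfolding bundle_chart_def by blast
  qed
qed

section \<open>The root map as a morphism of fans\<close>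

lemma roots_at_in_apartment:
  assumes "\<delta> \<in> \<Delta>" "chart \<delta> b" "x \<in> \<delta>"
  shows "roots_at x \<in> apartment_region b"
  unfolding apartment_region_def using root_flat_eq[OF assms] mcl_subset by simp

lemma root_map_eq: "root_map u x = mod_ones (roots_at x)"
  by (simp add: root_map_def)

lemma linear_root_map: "linear (root_map u)"
proof -
  have "root_map u = mod_ones \<circ> roots_at" by (auto simp: root_map_def)
  then show ?thesis using linear_compose[OF linear_roots_at linear_mod_ones] by simp
qed

lemma surj_root_map: "surj (root_map u)"
proof (rule surjI)
  fix z :: "'r mod_ones"
  obtain y where y: "z = mod_ones y" by (rule mod_ones_cases)
  obtain x c where "roots_at x = y + c *\<^sub>R 1" by (rule roots_at_surj)
  then have "root_map u x = z" using y by (simp only: root_map_eq mod_ones_shift)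
  then show "root_map u (SOME x. root_map u x = z) = z" by (rule someI)
qed

text \<open>A small generic displacement of an interior point of \<open>\<delta>\<close> leads into a cone that
  contains \<open>\<delta>\<close> as a face and whose image meets the interior of a chamber.\<close>

lemma ex_generic_cone:
  assumes "\<delta> \<in> \<Delta>"
  obtains \<delta>' x where "\<delta>' \<in> \<Delta>" "\<delta> \<subseteq> \<delta>'" "x \<in> \<delta>'" "inj (($) (roots_at x))"
proof -
  have fan: "fan N \<Delta>" and cov: "\<Union>\<Delta> = UNIV" and fin: "finite \<Delta>"
    using complete unfolding complete_fan_def fan_def by auto
  obtain S where S: "finite S" "\<delta> = convex_cone hull S"
    using fan assms unfolding fan_def by (metis rational_cone_def)
  \<comment> \<open>All generators have coefficient 1, so every face containing \<open>x\<close>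
    contains all of them.\<close>
  define x where "x = (\<Sum>s\<in>S. 1 *\<^sub>R s)"
  obtain g :: "real^'r" where g: "inj (($) g)" by (rule ex_injective_vector)
  obtain z c where z: "roots_at z = g + c *\<^sub>R 1" by (rule roots_at_surj)
  have uz: "u i z \<noteq> u j z" if "i \<noteq> j" for i j
  proof -
    have "u k z = g $ k + c" for k using z by (simp add: vec_eq_iff)
    then show ?thesis using injD[OF g, of i j] that by auto
  qed
  \<comment> \<open>For \<open>i \<noteq> j\<close> these are the times at which two roots agree on
    the line; the pairs with \<open>i = j\<close> add only 0.\<close>
  define bad where "bad = (\<lambda>(i, j). (u j x - u i x) / (u i z - u j z)) ` UNIV"
  have bad: "inj (($) (roots_at (x + t *\<^sub>R z)))" if "t \<notin> bad" for t
  proof (rule injI, rule ccontr)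
    fix i j assume "roots_at (x + t *\<^sub>R z) $ i = roots_at (x + t *\<^sub>R z) $ j" "i \<noteq> j"
    then have "u i x + t * u i z = u j x + t * u j z"
      by (simp add: linear_add[OF linear_root] linear_scale[OF linear_root])
    then have "t = (u j x - u i x) / (u i z - u j z)"
      using uz[OF \<open>i \<noteq> j\<close>] by (simp add: field_simps)
    then have "t \<in> bad" unfolding bad_def by (intro image_eqI[of _ _ "(i, j)"]) auto
    then show False using that by blast
  qed
  \<comment> \<open>Avoiding \<open>K\<close> ensures that a cone containing the displaced point
    also contains \<open>x\<close>.\<close>
  define K where "K = (\<Union>\<sigma>\<in>{\<sigma> \<in> \<Delta>. x \<notin> \<sigma>}. {t :: real. x + t *\<^sub>R z \<in> \<sigma>})"
  have "closed K" unfolding K_def using fin closed_line_cone by (intro closed_UN) auto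
  moreover have "0 \<notin> K" unfolding K_def by simp
  ultimately obtain e where e: "0 < e" "ball 0 e \<subseteq> - K"
    using open_contains_ball[of "- K"] by (auto simp: open_Compl)
  have "infinite {0<..<e}" using e(1) by (rule infinite_Ioo)
  moreover have "finite bad" unfolding bad_def by simp
  ultimately have "infinite ({0<..<e} - bad)" by simp
  then have "{0<..<e} - bad \<noteq> {}" by (metis finite.emptyI)
  then obtain t where "t \<in> {0<..<e} - bad" by blast
  then have t: "0 < t" "t < e" "t \<notin> bad" by auto
  obtain \<delta>' where \<delta>': "\<delta>' \<in> \<Delta>" "x + t *\<^sub>R z \<in> \<delta>'" using cov by blast
  have "t \<notin> K" using e(2) t(1,2) by (auto simp: subset_iff)
  then have "x \<in> \<delta>'" using \<delta>' unfolding K_def by blast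
  moreover have "x \<in> \<delta>"
    unfolding x_def S(2) by (rule convex_cone_sum[OF convex_cone_convex_cone_hull]) (auto intro: hull_inc)
  moreover have "\<delta> \<inter> \<delta>' face_of convex_cone hull S"
    using fan assms \<delta>'(1) S(2) unfolding fan_def by blast
  ultimately have "S \<subseteq> \<delta>'"
    using generator_in_face_of[OF _ S(1), of "\<delta> \<inter> \<delta>'" "\<lambda>s. 1"] unfolding x_def by auto
  moreover have "convex_cone \<delta>'"
    using fan \<delta>'(1) convex_cone_convex_cone_hull unfolding fan_def by (metis rational_cone_def)
  ultimately have "\<delta> \<subseteq> \<delta>'" unfolding S(2) by (rule hull_minimal)
  then show thesis using that \<delta>' bad[OF t(3)] by blast
qed

text \<open>The basis of a chart on \<open>\<delta>'\<close> is adapted at a generic point, so the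
  region of that point contains the whole apartment region and with it the image of
  \<open>\<delta>\<close>.\<close>

lemma fan_morphism_root_map: "fan_morphism N \<Delta> mod_ones_lattice region_fan (root_map u)"
  unfolding fan_morphism_def
proof (intro conjI ballI)
  show "linear (root_map u)" by (rule linear_root_map)
  show "root_map u ` N \<subseteq> mod_ones_lattice"
    using roots unfolding global_chern_roots_def dual_lattice_def mod_ones_lattice_def int_vectors_def root_map_def
    by auto
  fix \<delta> assume "\<delta> \<in> \<Delta>"
  then obtain \<delta>' x where \<delta>': "\<delta>' \<in> \<Delta>" "\<delta> \<subseteq> \<delta>'" "x \<in> \<delta>'" and w: "inj (($) (roots_at x))"
    by (rule ex_generic_cone)
  obtain b where b: "chart \<delta>' b" using roots \<delta>'(1) unfolding global_chern_roots_def by blast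
  then have "ordered_basis indep b" unfolding bundle_chart_def by blast
  then have "apartment_region b \<subseteq> region (roots_at x)"
    using apartment_region_subset_region roots_at_in_apartment[OF \<delta>'(1) b \<delta>'(3)] by blast
  then have "root_map u ` \<delta> \<subseteq> mod_ones ` region (roots_at x)"
    using roots_at_in_apartment[OF \<delta>'(1) b] \<delta>'(2) unfolding root_map_def by blast
  then show "\<exists>\<xi>\<in>region_fan. root_map u ` \<delta> \<subseteq> \<xi>" using region_in_fan[OF w] by blast
qed

lemma flat_vector_root_map:
  assumes "\<delta> \<in> \<Delta>" "chart \<delta> b" "x \<in> \<delta>"
  shows "flat_vector (mod_ones_section j (root_map u x)) = apartment_map indep b (roots_at x + (- u j x) *\<^sub>R 1)"
proof -
  have "roots_at x + (- u j x) *\<^sub>R 1 \<in> apartment_region b"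
    unfolding apartment_region_def mem_Collect_eq
  proof
    fix t
    have "{i. t \<le> (roots_at x + (- u j x) *\<^sub>R 1) $ i} = {i. t + u j x \<le> roots_at x $ i}"
      by (auto simp: algebra_simps)
    then show "b ` {i. t \<le> (roots_at x + (- u j x) *\<^sub>R 1) $ i} \<subseteq> root_flat {i. t \<le> (roots_at x + (- u j x) *\<^sub>R 1) $ i}"
      using roots_at_in_apartment[OF assms] unfolding apartment_region_def by simp
  qed
  moreover have "mod_ones_section j (root_map u x) = roots_at x + (- u j x) *\<^sub>R 1"
    unfolding root_map_def mod_ones_section by simp
  moreover have "ordered_basis indep b" using assms(2) unfolding bundle_chart_def by blast
  ultimately show ?thesis using flat_vector_apartment[OF loopless] by simp
qed

end

lemma bergman_fan_shift:
  assumes "v \<in> \<Union>(bergman_fan indep)" shows "v + c *\<^sub>R 1 \<in> \<Union>(bergman_fan indep)"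
proof -
  obtain \<F> x d where *: "chain\<^sub>\<subseteq> \<F> \<and> (\<forall>F\<in>\<F>. mflat indep F \<and> F \<noteq> {} \<and> F \<noteq> UNIV)"
    "x \<in> convex_cone hull (ind_vec ` \<F>)" "v = x + d *\<^sub>R 1"
    using assms unfolding bergman_fan_def by auto
  have "v + c *\<^sub>R 1 = x + (d + c) *\<^sub>R 1" using *(3) by (simp add: scaleR_left.add)
  then have "v + c *\<^sub>R 1 \<in> {x + c *\<^sub>R 1 | x c. x \<in> convex_cone hull (ind_vec ` \<F>)}" using *(2) by blast
  then show ?thesis using *(1) unfolding bergman_fan_def by blast
qed

theorem theorem1p1:
  fixes N :: "'a::real_vector set"
    and indep :: "'e::finite set \<Rightarrow> bool"
    and \<Delta> :: "'a set set"
    and \<Phi> :: "'a \<Rightarrow> real^'e"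
    and u :: "'r::finite \<Rightarrow> 'a \<Rightarrow> real"
  assumes "lattice_in N"
    and "matroid indep" and "loopless indep" and "mrank indep UNIV = CARD('r)"
    and "complete_fan N \<Delta>"
    and "tropical_bundle TYPE('r) N indep \<Delta> \<Phi>"
    and "trivial_chern_class TYPE('r) N indep \<Delta> \<Phi>"
    and "global_chern_roots N indep \<Delta> \<Phi> u"
    and "affinely_independent u"
  shows "\<exists>(\<Xi> :: 'r mod_ones set set) \<Psi> v.
    complete_fan mod_ones_lattice \<Xi> \<and> coarsens \<Xi> permutohedral_fan \<and>
    tropical_bundle TYPE('r) mod_ones_lattice indep \<Xi> \<Psi> \<and>
    v \<in> dual_lattice N \<and>
    fan_morphism N \<Delta> mod_ones_lattice \<Xi> (root_map u) \<and> surj (root_map u) \<and>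
    (\<forall>x\<in>\<Union>\<Delta>. (\<Psi> \<circ> root_map u) x = twist TYPE('r) N indep \<Delta> \<Phi> v x)"
proof -
  interpret split_bundle indep N \<Delta> \<Phi> u
    by unfold_locales (use assms in auto)
  fix j :: 'r
  \<comment> \<open>The section that makes coordinate \<open>j\<close> zero corresponds to the twist
    by the negative of root \<open>j\<close>.\<close>
  define \<Psi> where "\<Psi> z = flat_vector (mod_ones_section j z)" for z
  define v where "v x = - u j x" for x
  have \<Psi>: "\<Psi> (root_map u x) = twist TYPE('r) N indep \<Delta> \<Phi> v x"
    "\<Psi> (root_map u x) = \<Phi> x + v x *\<^sub>R 1" for x
  proof -
    obtain \<delta> b where *: "\<delta> \<in> \<Delta>" "x \<in> \<delta>" "chart \<delta> b" by (rule cover)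
    have eq: "\<Psi> (root_map u x) = apartment_map indep b (roots_at x + v x *\<^sub>R 1)"
      unfolding \<Psi>_def v_def by (rule flat_vector_root_map[OF *(1,3,2)])
    then show "\<Psi> (root_map u x) = twist TYPE('r) N indep \<Delta> \<Phi> v x"
      using twist_chart[OF assms(2,3) *] by simp
    show "\<Psi> (root_map u x) = \<Phi> x + v x *\<^sub>R 1"
      using * unfolding eq bundle_chart_def by (simp only: apartment_map_shift[OF assms(2,3)])
  qed
  have "v \<in> dual_lattice N"
    using assms(8) linear_compose_neg[OF linear_root[of j]]
    unfolding global_chern_roots_def dual_lattice_def v_def by (auto simp: fun_Compl_def)
  moreover have "tropical_bundle TYPE('r) mod_ones_lattice indep region_fan \<Psi>"
    unfolding tropical_bundle_def
  proof (intro conjI ballI)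
    show "\<Psi> ` \<Union>region_fan \<subseteq> \<Union>(bergman_fan indep)"
    proof (rule image_subsetI)
      fix z :: "'r mod_ones"
      obtain x where x: "z = root_map u x" using surj_root_map by (rule surjE)
      \<comment> \<open>Surjectivity of the root map transfers membership from
        \<open>\<Phi>\<close>, since the two values differ by a multiple of
        \<open>1\<close>.\<close>
      have "\<Phi> x \<in> \<Union>(bergman_fan indep)"
        using assms(5,6) unfolding tropical_bundle_def complete_fan_def by blast
      then show "\<Psi> z \<in> \<Union>(bergman_fan indep)" unfolding x \<Psi>(2) by (rule bergman_fan_shift)
    qed
    show "\<exists>(b :: 'r \<Rightarrow> 'e) T. bundle_chart mod_ones_lattice indep \<Psi> \<tau> b T" if "\<tau> \<in> region_fan" for \<tau>
      using region_fan_chart[OF loopless that, of j] unfolding \<Psi>_def by blast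
  qed
  ultimately show ?thesis
    using complete_fan_region_fan coarsens_region_fan fan_morphism_root_map surj_root_map \<Psi>(1)
    by (intro exI[of _ region_fan] exI[of _ \<Psi>] exI[of _ v]) auto
qed

end
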